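(* For every $0<c\le 1/2$ there exist a real-valued function $f\in\bigcap_{1\le p<\infty}L^p(\mathbb T)$ with $\int_{\mathbb T} f=0$ and an increasing sequence of positive integers $(n_j)_{j\ge1}$ with $n_{j+1}/n_j\ge2$ for all $j$ such that $$\|f-S_Nf\|_2\ll (\log\log N)^{-c}$$ for all sufficiently large $N$, while $$\limsup_{N\to\infty}\frac1N\sum_{j\le N}f(n_jx)=+\infty$$ for almost every $x\in\mathbb T$.
   Context: $\mathbb T=\mathbb R/\mathbb Z$ with normalized Lebesgue measure; $\|\cdot\|_2$ is the $L^2(\mathbb T)$ norm. For $f\in L^2(\mathbb T)$, $S_Nf(x)=\sum_{|m|\le N}\widehat f(m)e^{2\pi i m x}$ is the symmetric Fourier partial sum. $A(N)\ll B(N)$ means $A(N)\le K\,B(N)$ for some constant $K>0$ independent of $N$. *)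

theory Defs
  imports "HOL-Analysis.Analysis"
begin

text \<open>
  Functions on the circle \<open>\<real>/\<int>\<close> are represented by 1-periodic functions on the real line;
  the fundamental domain \<open>{0..<1}\<close> carries the normalized Lebesgue measure.
\<close>

definition circle_measure :: "real measure" where
  "circle_measure = lebesgue_on {0..<1}"

text \<open>Functions are not identified almost everywhere: members of \<open>Lp_circle p\<close> are representatives.\<close>

definition Lp_circle :: "real \<Rightarrow> (real \<Rightarrow> 'a::real_normed_vector) set" where
  "Lp_circle p = {f. (\<forall>x. f (x + 1) = f x) \<and> f \<in> borel_measurable circle_measure \<and>
                     integrable circle_measure (\<lambda>x. norm (f x) powr p)}"

definition L2_norm_circle :: "(real \<Rightarrow> complex) \<Rightarrow> real" where
  "L2_norm_circle f = sqrt (LINT x|circle_measure. (norm (f x))\<^sup>2)"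

definition fourier_coeff :: "(real \<Rightarrow> complex) \<Rightarrow> int \<Rightarrow> complex" where
  "fourier_coeff f m =
     (LINT x|circle_measure. f x * exp (- 2 * complex_of_real pi * \<i> * of_int m * of_real x))"

definition fourier_partial_sum :: "nat \<Rightarrow> (real \<Rightarrow> complex) \<Rightarrow> real \<Rightarrow> complex" where
  "fourier_partial_sum N f x =
     (\<Sum>m | \<bar>m\<bar> \<le> int N. fourier_coeff f m * exp (2 * complex_of_real pi * \<i> * of_int m * of_real x))"

end

theory Submission
  imports Defs "HOL-Library.Discrete_Functions" "HOL-Real_Asymp.Real_Asymp"
begin

text \<open>
  The function is a sum of nonnegative layers minus its mean. Layer \<open>k\<close> is \<open>height k\<close> times a smooth
  version of the indicator of the event \<open>A k\<close> that one of \<open>2 T\<close> consecutive digits of \<open>x\<close> in a large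
  base is zero, where \<open>T = 2 ^ 2 ^ (k + 1)\<close>. It is a trigonometric polynomial of degree at most
  \<open>2 ^ 2 ^ 2 ^ (k + 3)\<close>, and its squared $L^2$ norm is at most \<open>2 * 2 ^ - k\<close>, so the tail beyond
  frequency \<open>N\<close> has norm of order \<open>(ln (ln N)) powr (- 1 / 2)\<close>.

  The event \<open>A k\<close> is almost invariant under shifting \<open>x\<close> by up to \<open>T\<close> digits. Hence a block of up to
  \<open>T\<close> dilations, each shifting by one digit more, sees layer \<open>k\<close> at height at least \<open>height k / 2\<close>
  throughout, for a set of \<open>x\<close> about as large as \<open>A k\<close>. As the block lengths are powers of two, layer
  \<open>k\<close> can serve \<open>2 ^ k\<close> blocks, each as long as all the previous ones together, and blocks reading
  disjoint sets of digits are independent. The measures of these sets have a divergent sum although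
  \<open>height k\<close> tends to infinity, and since all layers are nonnegative nothing can cancel the gain.
\<close>

subsection \<open>Trigonometric polynomials on the circle\<close>

lemma space_circle_measure [simp]: "space circle_measure = {0..<1}"
  by (simp add: circle_measure_def)

interpretation circle: finite_measure circle_measure
  unfolding circle_measure_def by (rule finite_measure_lebesgue_on) (simp add: fmeasurable_def)

lemma measure_circle_measure_space [simp]: "measure circle_measure {0..<1} = 1"
  by (simp add: circle_measure_def measure_restrict_space)

lemma borel_measurable_circle_measure:
  "g \<in> borel_measurable borel \<Longrightarrow> g \<in> borel_measurable circle_measure"
  unfolding circle_measure_def
  by (intro measurable_restrict_space1 measurable_completion) simp

lemma integrable_circle_bounded:
  fixes g :: "real \<Rightarrow> 'a::{banach, second_countable_topology}"
  assumes "g \<in> borel_measurable borel" "\<And>x. norm (g x) \<le> B"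
  shows "integrable circle_measure g"
  using assms by (intro circle.integrable_const_bound[where B=B] borel_measurable_circle_measure) auto

definition ee :: "int \<Rightarrow> real \<Rightarrow> complex" where
  "ee m x = exp (2 * complex_of_real pi * \<i> * of_int m * of_real x)"

lemma ee_cis: "ee m x = cis (2 * pi * of_int m * x)"
  by (simp add: ee_def cis_conv_exp mult_ac)

lemma ee_add: "ee (m + n) x = ee m x * ee n x"
  by (simp add: ee_cis cis_mult ring_distribs)

lemma cnj_ee: "cnj (ee m x) = ee (- m) x"
  by (simp add: ee_cis cis_cnj)

lemma norm_ee [simp]: "norm (ee m x) = 1"
  by (simp add: ee_cis)

lemma ee_0 [simp]: "ee 0 x = 1"
  by (simp add: ee_cis)

lemma ee_scale: "ee m (real D * x) = ee (m * int D) x"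
  by (simp add: ee_cis mult_ac)

lemma ee_periodic: "ee m (x + 1) = ee m x"
  by (simp add: ee_cis ring_distribs flip: cis_mult)

lemma continuous_on_ee [continuous_intros]: "continuous_on A (ee m)"
  unfolding ee_def by (intro continuous_intros)

lemma borel_measurable_ee [measurable]: "ee m \<in> borel_measurable borel"
  by (intro borel_measurable_continuous_onI continuous_intros)

lemma integral_ee: "(LINT x|circle_measure. ee m x) = (if m = 0 then 1 else 0)"
proof (cases "m = 0")
  case False
  define F where "F = (\<lambda>x. ee m x / (2 * complex_of_real pi * \<i> * of_int m))"
  have d: "(F has_vector_derivative ee m x) (at x within A)" for x A
    unfolding F_def ee_def using False
    by (intro has_vector_derivative_real_field) (auto intro!: derivative_eq_intros)
  have "(ee m has_integral (F 1 - F 0)) {0..1}"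
    by (intro fundamental_theorem_of_calculus d) auto
  moreover have "F 1 = F 0"
    using ee_periodic[of m 0] by (simp add: F_def)
  ultimately have "(ee m has_integral 0) {0..1}"
    by simp
  then have i0: "(ee m has_integral 0) {0..<1}"
    by (subst has_integral_spike_set_eq[of _ "{0..1}"])
      (auto intro: negligible_subset[of "{1}"] empty_imp_negligible)
  have "integrable (lebesgue_on {0..<1}) (ee m)"
    using integrable_circle_bounded[of "ee m" 1] by (simp add: circle_measure_def)
  then have "(LINT x|circle_measure. ee m x) = integral {0..<1} (ee m)"
    unfolding circle_measure_def by (intro lebesgue_integral_eq_integral) auto
  then show ?thesis using i0 False by (simp add: integral_unique)
qed simp

lemma integrable_ee: "integrable circle_measure (ee m)"
  by (rule integrable_circle_bounded[of _ 1]) auto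

text \<open>An inductive description makes closure under sums, products, conjugation and dilation a
  matter of rule induction. Only the bound \<open>N\<close> on the degree is tracked, never the
  coefficients.\<close>

inductive trig_poly :: "nat \<Rightarrow> (real \<Rightarrow> complex) \<Rightarrow> bool" for N where
  trig_poly_zero: "trig_poly N (\<lambda>x. 0)"
| trig_poly_add_term: "trig_poly N g \<Longrightarrow> \<bar>m\<bar> \<le> int N \<Longrightarrow> trig_poly N (\<lambda>x. g x + a * ee m x)"

lemma trig_poly_term: "\<bar>m\<bar> \<le> int N \<Longrightarrow> trig_poly N (\<lambda>x. a * ee m x)"
  using trig_poly_add_term[OF trig_poly_zero] by simp

lemma trig_poly_ee: "\<bar>m\<bar> \<le> int N \<Longrightarrow> trig_poly N (ee m)"
  using trig_poly_term[of m N 1] by simp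

lemma trig_poly_const: "trig_poly N (\<lambda>x. a)"
  using trig_poly_term[of 0 N a] by simp

lemma trig_poly_mono: "trig_poly N g \<Longrightarrow> N \<le> M \<Longrightarrow> trig_poly M g"
  by (induction rule: trig_poly.induct) (auto intro: trig_poly.intros)

lemma trig_poly_add:
  assumes "trig_poly N g" "trig_poly N h" shows "trig_poly N (\<lambda>x. g x + h x)"
  using assms(2)
proof (induction rule: trig_poly.induct)
  case (trig_poly_add_term h m a)
  then show ?case using trig_poly.trig_poly_add_term[of N "\<lambda>x. g x + h x" m a] by (simp add: add.assoc)
qed (use assms in simp)

lemma trig_poly_mult:
  assumes "trig_poly N g" "trig_poly M h" shows "trig_poly (N + M) (\<lambda>x. g x * h x)"
  using assms(2)
proof (induction rule: trig_poly.induct)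
  case trig_poly_zero
  then show ?case by (simp add: trig_poly.trig_poly_zero)
next
  case (trig_poly_add_term h m a)
  have "trig_poly (N + M) (\<lambda>x. g x * (a * ee m x))"
    using assms(1)
  proof (induction rule: trig_poly.induct)
    case trig_poly_zero
    then show ?case by (simp add: trig_poly.trig_poly_zero)
  next
    case IH: (trig_poly_add_term g n b)
    have "\<bar>n + m\<bar> \<le> int (N + M)" using IH trig_poly_add_term by auto
    from trig_poly.trig_poly_add_term[OF IH(3) this, of "b * a"] show ?case
      by (simp add: ring_distribs ee_add mult_ac)
  qed
  from trig_poly_add[OF trig_poly_add_term(3) this] show ?case by (simp add: ring_distribs)
qed

lemma trig_poly_cmult: "trig_poly N g \<Longrightarrow> trig_poly N (\<lambda>x. a * g x)"
  using trig_poly_mult[OF trig_poly_const[of 0 a]] by simp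

lemma trig_poly_diff:
  "trig_poly N g \<Longrightarrow> trig_poly N h \<Longrightarrow> trig_poly N (\<lambda>x. g x - h x)"
  using trig_poly_add[OF _ trig_poly_cmult[of N h "-1"]] by simp

lemma trig_poly_sum:
  "(\<And>i. i \<in> A \<Longrightarrow> trig_poly N (g i)) \<Longrightarrow> trig_poly N (\<lambda>x. \<Sum>i\<in>A. g i x)"
  by (induction A rule: infinite_finite_induct) (auto intro: trig_poly_zero trig_poly_add)

lemma trig_poly_cnj: "trig_poly N g \<Longrightarrow> trig_poly N (\<lambda>x. cnj (g x))"
proof (induction rule: trig_poly.induct)
  case (trig_poly_add_term g m a)
  then have "\<bar>- m\<bar> \<le> int N" by simp
  from trig_poly.trig_poly_add_term[OF trig_poly_add_term(3) this, of "cnj a"] show ?case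
    by (simp add: cnj_ee)
qed (simp add: trig_poly_zero)

lemma trig_poly_scale: "trig_poly N g \<Longrightarrow> trig_poly (N * D) (\<lambda>x. g (real D * x))"
proof (induction rule: trig_poly.induct)
  case (trig_poly_add_term g m a)
  then have "\<bar>m * int D\<bar> \<le> int (N * D)" by (simp add: abs_mult mult_right_mono)
  from trig_poly.trig_poly_add_term[OF trig_poly_add_term(3) this, of a] show ?case
    by (simp add: ee_scale)
qed (simp add: trig_poly_zero)

lemma borel_measurable_trig_poly: "trig_poly N g \<Longrightarrow> g \<in> borel_measurable borel"
  by (induction rule: trig_poly.induct) auto

lemma trig_poly_bounded: "trig_poly N g \<Longrightarrow> \<exists>B. \<forall>x. norm (g x) \<le> B"
proof (induction rule: trig_poly.induct)
  case (trig_poly_add_term g m a)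
  then obtain B where "\<And>x. norm (g x) \<le> B" by auto
  then have "norm (g x + a * ee m x) \<le> B + norm a" for x
    by (intro order.trans[OF norm_triangle_ineq] add_mono) (auto simp: norm_mult)
  then show ?case by blast
qed auto

lemma trig_poly_periodic: "trig_poly N g \<Longrightarrow> g (x + 1) = g x"
  by (induction rule: trig_poly.induct) (auto simp: ee_periodic)

lemma integrable_mult_trig_poly:
  assumes g: "integrable circle_measure g" and h: "trig_poly N h"
  shows "integrable circle_measure (\<lambda>x. g x * h x)"
proof -
  obtain B where "\<And>x. norm (h x) \<le> B" using trig_poly_bounded[OF h] by auto
  then have "norm (h x) \<le> \<bar>B\<bar>" for x
    by (rule order.trans[OF _ abs_ge_self])
  then have le: "norm (g x * h x) \<le> norm (norm (g x) * B)" for x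
    by (simp add: norm_mult abs_mult mult_left_mono)
  have [measurable]: "h \<in> borel_measurable circle_measure" "g \<in> borel_measurable circle_measure"
    using g borel_measurable_circle_measure[OF borel_measurable_trig_poly[OF h]] by auto
  have "integrable circle_measure (\<lambda>x. norm (g x) * B)" using g by simp
  then show ?thesis
    by (rule Bochner_Integration.integrable_bound) (measurable, intro AE_I2 le)
qed

lemma integrable_trig_poly: "trig_poly N g \<Longrightarrow> integrable circle_measure g"
  using integrable_mult_trig_poly[of "\<lambda>_. 1"] by simp

section \<open>Fourier partial sums and best approximation in L^2\<close>

lemma fourier_coeff_ee: "fourier_coeff g m = (LINT x|circle_measure. g x * ee (- m) x)"
  by (simp add: fourier_coeff_def ee_def)

lemma fourier_partial_sum_ee:
  "fourier_partial_sum N g x = (\<Sum>m | \<bar>m\<bar> \<le> int N. fourier_coeff g m * ee m x)"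
  by (simp add: fourier_partial_sum_def ee_def)

lemma trig_poly_fourier_partial_sum: "trig_poly N (fourier_partial_sum N g)"
  unfolding fourier_partial_sum_ee[abs_def] by (intro trig_poly_sum trig_poly_term) simp

lemma finite_frequencies: "finite {m. \<bar>m\<bar> \<le> int N}"
  by (rule finite_subset[of _ "{- int N..int N}"]) auto

lemma fourier_coeff_partial_sum:
  assumes "\<bar>k\<bar> \<le> int N"
  shows "fourier_coeff (fourier_partial_sum N g) k = fourier_coeff g k"
proof -
  have "fourier_coeff (fourier_partial_sum N g) k
      = (LINT x|circle_measure. (\<Sum>m | \<bar>m\<bar> \<le> int N. fourier_coeff g m * ee (m - k) x))"
    by (simp add: fourier_coeff_ee fourier_partial_sum_ee sum_distrib_right mult.assoc flip: ee_add)
  also have "\<dots> = (\<Sum>m | \<bar>m\<bar> \<le> int N. fourier_coeff g m * (if m = k then 1 else 0))"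
    by (subst Bochner_Integration.integral_sum)
      (auto intro!: sum.cong integrable_ee simp: integral_ee)
  also have "\<dots> = fourier_coeff g k"
    using assms by (simp add: finite_frequencies if_distrib[of "\<lambda>z. _ * z"] cong: if_cong)
  finally show ?thesis .
qed

lemma integral_mult_trig_poly_eq_0:
  assumes v: "integrable circle_measure v"
    and v0: "\<And>m. \<bar>m\<bar> \<le> int N \<Longrightarrow> fourier_coeff v m = 0"
    and q: "trig_poly N q"
  shows "(LINT x|circle_measure. v x * q x) = 0"
  using q
proof (induction rule: trig_poly.induct)
  case (trig_poly_add_term g m a)
  have "(LINT x|circle_measure. v x * ee m x) = 0"
    using v0[of "-m"] trig_poly_add_term by (simp add: fourier_coeff_ee)
  moreover have "integrable circle_measure (\<lambda>x. v x * ee m x)"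
    "integrable circle_measure (\<lambda>x. v x * g x)"
    using integrable_mult_trig_poly[OF v trig_poly_ee] integrable_mult_trig_poly[OF v] trig_poly_add_term
    by blast+
  ultimately show ?case using trig_poly_add_term(3)
    by (simp add: ring_distribs mult.left_commute[of _ a])
qed simp

text \<open>Pythagoras: \<open>g - P\<close> is the sum of \<open>v = g - ?S\<close>, which is
  orthogonal to all trigonometric polynomials of degree at most \<open>N\<close>, and of such a
  polynomial \<open>q\<close>. Partial sums can thus be replaced by any explicit polynomial when the
  error is bounded from above.\<close>

lemma L2_norm_diff_fourier_partial_sum_le:
  assumes g: "g \<in> borel_measurable circle_measure"
    and g2: "integrable circle_measure (\<lambda>x. (norm (g x))\<^sup>2)"
    and P: "trig_poly N P"
  shows "L2_norm_circle (\<lambda>x. g x - fourier_partial_sum N g x) \<le> L2_norm_circle (\<lambda>x. g x - P x)"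
proof -
  let ?S = "fourier_partial_sum N g"
  define v where "v = (\<lambda>x. g x - ?S x)"
  define q where "q = (\<lambda>x. ?S x - P x)"
  have S: "trig_poly N ?S" by (rule trig_poly_fourier_partial_sum)
  have q: "trig_poly N q" unfolding q_def by (intro trig_poly_diff S P)
  have gi: "integrable circle_measure g"
  \<comment> \<open>Square integrable functions are integrable on a finite measure space, because
    \<open>t \<le> 1 + t * t\<close> for every real \<open>t\<close>.\<close>
  proof (rule Bochner_Integration.integrable_bound[of _ "\<lambda>x. 1 + (norm (g x))\<^sup>2"])
    have "norm (g x) \<le> 1 + (norm (g x))\<^sup>2" for x
      using zero_le_power2[of "norm (g x) - 1"] by (simp add: power2_eq_square algebra_simps) (smt (verit) norm_ge_zero)
    then show "AE x in circle_measure. norm (g x) \<le> norm (1 + (norm (g x))\<^sup>2)"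
      by (simp add: abs_of_nonneg)
  qed (use g g2 in auto)
  have vi: "integrable circle_measure v"
    unfolding v_def by (intro Bochner_Integration.integrable_diff gi integrable_trig_poly[OF S])
  have v0: "fourier_coeff v m = 0" if "\<bar>m\<bar> \<le> int N" for m
  proof -
    have "\<bar>-m\<bar> \<le> int N" using that by simp
    then have "trig_poly N (ee (- m))" by (rule trig_poly_ee)
    then have "fourier_coeff v m = fourier_coeff g m - fourier_coeff ?S m"
      unfolding fourier_coeff_ee v_def
      by (simp add: left_diff_distrib integrable_mult_trig_poly[OF gi] integrable_mult_trig_poly[OF integrable_trig_poly[OF S]])
    then show ?thesis using fourier_coeff_partial_sum[OF that] by simp
  qed
  have vq: "integrable circle_measure (\<lambda>x. v x * cnj (q x))"
    by (rule integrable_mult_trig_poly[OF vi trig_poly_cnj[OF q]])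
  have "(LINT x|circle_measure. v x * cnj (q x)) = 0"
    by (rule integral_mult_trig_poly_eq_0[OF vi v0 trig_poly_cnj[OF q]])
  then have vq0: "(LINT x|circle_measure. Re (v x * cnj (q x))) = 0"
    using integral_Re[OF vq] by simp
  have qq: "integrable circle_measure (\<lambda>x. (norm (q x))\<^sup>2)"
  proof -
    have "integrable circle_measure (\<lambda>x. Re (q x * cnj (q x)))"
      by (intro integrable_Re integrable_mult_trig_poly[OF integrable_trig_poly trig_poly_cnj, OF q q])
    then show ?thesis by (simp add: complex_norm_square[symmetric] Re_complex_of_real flip: of_real_power)
  qed
  have gS: "integrable circle_measure (\<lambda>x. (norm (v x))\<^sup>2)"
  proof (rule Bochner_Integration.integrable_bound[of _ "\<lambda>x. 2 * (norm (g x))\<^sup>2 + 2 * (norm (?S x))\<^sup>2"])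
    have "integrable circle_measure (\<lambda>x. Re (?S x * cnj (?S x)))"
      by (intro integrable_Re integrable_mult_trig_poly[OF integrable_trig_poly trig_poly_cnj, OF S S])
    then have "integrable circle_measure (\<lambda>x. (norm (?S x))\<^sup>2)"
      by (simp add: complex_norm_square[symmetric] flip: of_real_power)
    then show "integrable circle_measure (\<lambda>x. 2 * (norm (g x))\<^sup>2 + 2 * (norm (?S x))\<^sup>2)"
      using g2 by simp
    have "(norm (v x))\<^sup>2 \<le> 2 * (norm (g x))\<^sup>2 + 2 * (norm (?S x))\<^sup>2" for x
    proof -
      have "(norm (v x))\<^sup>2 \<le> (norm (g x) + norm (?S x))\<^sup>2"
        unfolding v_def by (intro power_mono norm_triangle_ineq4) auto
      also have "\<dots> \<le> 2 * (norm (g x))\<^sup>2 + 2 * (norm (?S x))\<^sup>2"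
        using zero_le_power2[of "norm (g x) - norm (?S x)"] by (simp add: power2_eq_square algebra_simps)
      finally show ?thesis .
    qed
    then show "AE x in circle_measure. norm ((norm (v x))\<^sup>2) \<le> norm (2 * (norm (g x))\<^sup>2 + 2 * (norm (?S x))\<^sup>2)"
      by (simp add: abs_of_nonneg)
  qed (use vi in auto)
  have eq: "(norm (g x - P x))\<^sup>2 = (norm (v x))\<^sup>2 + (2 * Re (v x * cnj (q x)) + (norm (q x))\<^sup>2)" for x
  proof -
    have "g x - P x = v x + q x" by (simp add: v_def q_def)
    then show ?thesis
      by (simp only: cmod_power2 plus_complex.sel times_complex.sel complex_cnj)
        (simp add: power2_eq_square algebra_simps)
  qed
  have "(LINT x|circle_measure. (norm (g x - P x))\<^sup>2)
      = (LINT x|circle_measure. (norm (v x))\<^sup>2) + (LINT x|circle_measure. (norm (q x))\<^sup>2)"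
    unfolding eq using vq0 gS qq integrable_Re[OF vq]
    by (simp del: times_complex.sel)
  moreover have "0 \<le> (LINT x|circle_measure. (norm (q x))\<^sup>2)" by simp
  ultimately show ?thesis
    unfolding L2_norm_circle_def v_def by simp
qed

subsection \<open>Series in $L^p$\<close>

text \<open>
  If \<open>B\<close> is the sum of \<open>(g k / w k) powr p\<close>, then \<open>g k \<le> w k * B powr (1 / p)\<close> for every \<open>k\<close>;
  summing over \<open>k\<close> replaces Minkowski's inequality.
\<close>
lemma
  fixes g :: "nat \<Rightarrow> 'a \<Rightarrow> real" and w c :: "nat \<Rightarrow> real"
  assumes g: "\<And>k. g k \<in> borel_measurable M" "\<And>k x. 0 \<le> g k x"
    and int: "\<And>k. integrable M (\<lambda>x. g k x powr p)"
    and le: "\<And>k. (LINT x|M. g k x powr p) \<le> w k powr p * c k"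
    and w: "summable w" "\<And>k. 0 < w k" and c: "summable c" and p: "1 \<le> p"
  shows AE_summable_powr: "AE x in M. summable (\<lambda>k. g k x)"
    and integrable_suminf_powr: "integrable M (\<lambda>x. (\<Sum>k. g k x) powr p)"
    and integral_suminf_powr_le: "(LINT x|M. (\<Sum>k. g k x) powr p) \<le> (\<Sum>k. w k) powr p * (\<Sum>k. c k)"
proof -
  define u where "u k x = g k x powr p / w k powr p" for k x
  define B where "B x = (\<Sum>k. u k x)" for x
  define W where "W = (\<Sum>k. w k)"
  have u0: "0 \<le> u k x" for k x by (simp add: u_def)
  have iu: "integrable M (u k)" for k
    using int[of k] by (simp add: u_def[abs_def])
  have ule: "(LINT x|M. u k x) \<le> c k" for k
    using le[of k] w(2)[of k] by (simp add: u_def divide_le_eq mult.commute)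
  have su: "summable (\<lambda>k. LINT x|M. norm (u k x))"
    by (rule summable_comparison_test'[OF c, of 0]) (use ule u0 in auto)
  have mu[measurable]: "u k \<in> borel_measurable M" for k using iu by auto
  \<comment> \<open>By monotone convergence the series of the \<open>u k\<close> has a finite
    integral, so it converges almost everywhere.\<close>
  have "(\<integral>\<^sup>+x. (\<Sum>k. ennreal (u k x)) \<partial>M) = (\<Sum>k. ennreal (LINT x|M. u k x))"
    by (subst nn_integral_suminf) (auto intro!: suminf_cong nn_integral_eq_integral iu u0)
  also have "\<dots> \<noteq> \<infinity>"
    using su u0 by (subst suminf_ennreal_eq[OF _ summable_sums]) auto
  finally have "AE x in M. (\<Sum>k. ennreal (u k x)) \<noteq> \<infinity>"
    by (intro nn_integral_PInf_AE) auto
  then have AEu: "AE x in M. summable (\<lambda>k. u k x)"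
    by eventually_elim (use u0 in \<open>auto intro: summable_suminf_not_top\<close>)
  have iB: "integrable M B" and "(LINT x|M. B x) = (\<Sum>k. LINT x|M. u k x)"
    unfolding B_def using AEu u0 iu su by (auto intro!: integrable_suminf integral_suminf)
  then have intB: "(LINT x|M. B x) \<le> (\<Sum>k. c k)"
    using su u0 by (auto intro!: suminf_le ule c)
  have key: "summable (\<lambda>k. g k x) \<and> (\<Sum>k. g k x) powr p \<le> W powr p * B x"
    if "summable (\<lambda>k. u k x)" for x
  proof -
    have uB: "u k x \<le> B x" for k
      unfolding B_def using sum_le_suminf[OF that, of "{k}"] u0 by auto
    have B0: "0 \<le> B x" using uB[of 0] u0[of 0 x] by linarith
    have gle: "g k x \<le> w k * B x powr (1/p)" for k
    proof -
      have "g k x = (g k x powr p) powr (1/p)" using p g(2) by (simp add: powr_powr)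
      also have "\<dots> \<le> (w k powr p * B x) powr (1/p)"
        using uB[of k] w(2)[of k] p by (intro powr_mono2) (auto simp: u_def divide_le_eq mult.commute)
      also have "\<dots> = w k * B x powr (1/p)"
        using p w(2)[of k] B0 by (simp add: powr_mult powr_powr)
      finally show ?thesis .
    qed
    have s: "summable (\<lambda>k. w k * B x powr (1/p))" using w by (intro summable_mult2)
    then have sg: "summable (\<lambda>k. g k x)"
      by (rule summable_comparison_test'[of _ 0]) (use gle g in auto)
    have "(\<Sum>k. g k x) \<le> W * B x powr (1/p)"
      using suminf_le[OF gle sg s] suminf_mult2[OF w(1), of "B x powr (1/p)"] by (simp add: W_def)
    then have "(\<Sum>k. g k x) powr p \<le> (W * B x powr (1/p)) powr p"
      using p suminf_nonneg[OF sg] g by (intro powr_mono2) auto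
    also have "\<dots> = W powr p * B x"
      using p B0 suminf_nonneg[OF w(1)] w(2) by (simp add: powr_mult powr_powr W_def less_imp_le)
    finally show ?thesis using sg by simp
  qed
  show "AE x in M. summable (\<lambda>k. g k x)"
    using AEu by eventually_elim (use key in auto)
  have [measurable]: "g k \<in> borel_measurable M" for k by (rule g)
  have AEle: "AE x in M. (\<Sum>k. g k x) powr p \<le> W powr p * B x"
    using AEu by eventually_elim (use key in auto)
  have iWB: "integrable M (\<lambda>x. W powr p * B x)" using iB by simp
  show iG: "integrable M (\<lambda>x. (\<Sum>k. g k x) powr p)"
    by (rule Bochner_Integration.integrable_bound[OF iWB]) (measurable, use AEle in eventually_elim, auto)
  have "(LINT x|M. (\<Sum>k. g k x) powr p) \<le> (LINT x|M. W powr p * B x)"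
    by (rule integral_mono_AE[OF iG iWB AEle])
  also have "\<dots> \<le> W powr p * (\<Sum>k. c k)"
    using intB by (simp add: mult_left_mono)
  finally show "(LINT x|M. (\<Sum>k. g k x) powr p) \<le> (\<Sum>k. w k) powr p * (\<Sum>k. c k)"
    by (simp add: W_def)
qed

subsection \<open>Smoothed runs of zero digits\<close>

text \<open>The Fejer kernel of order \<open>n\<close> divided by \<open>n\<close>, so that for
  positive \<open>n\<close> the peak value at the integers is 1 and the values lie between 0 and
  1.\<close>

definition fejer :: "nat \<Rightarrow> real \<Rightarrow> real" where
  "fejer n x = (norm (\<Sum>l<n. ee (int l) x))\<^sup>2 / (real n)\<^sup>2"

lemma fejer_nonneg: "0 \<le> fejer n x"
  by (simp add: fejer_def)

lemma fejer_le_1: "fejer n x \<le> 1"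
proof -
  have "norm (\<Sum>l<n. ee (int l) x) \<le> real n"
    using norm_sum[of "\<lambda>l. ee (int l) x" "{..<n}"] by simp
  then have "(norm (\<Sum>l<n. ee (int l) x))\<^sup>2 \<le> (real n)\<^sup>2"
    by (intro power_mono) auto
  then show ?thesis by (cases "n = 0") (simp_all add: fejer_def)
qed

lemma fejer_eq_sum:
  "complex_of_real (fejer n x) =
     (\<Sum>l<n. ee (int l) x) * cnj (\<Sum>l<n. ee (int l) x) * (1 / (of_nat n)\<^sup>2)"
  unfolding fejer_def complex_norm_square[symmetric] by simp

lemma trig_poly_fejer: "trig_poly (2 * n) (\<lambda>x. complex_of_real (fejer n x))"
proof -
  have "trig_poly n (\<lambda>x. \<Sum>l<n. ee (int l) x)"
    by (intro trig_poly_sum trig_poly_ee) auto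
  from trig_poly_mult[OF this trig_poly_cnj[OF this]] show ?thesis
    unfolding fejer_eq_sum mult_2
    by (subst mult.commute) (rule trig_poly_cmult)
qed

lemma fejer_add_int: "fejer n (x + of_int m) = fejer n x"
proof -
  have "ee l (x + of_int m) = ee l x" for l
  proof -
    have "ee l (x + of_int m) = ee l x * cis (2 * pi * of_int (l * m))"
      by (simp add: ee_cis cis_mult ring_distribs mult_ac)
    also have "cis (2 * pi * of_int (l * m)) = 1"
      by (rule cis_multiple_2pi) simp
    finally show ?thesis by simp
  qed
  then show ?thesis by (simp add: fejer_def)
qed

lemma borel_measurable_fejer [measurable]: "fejer n \<in> borel_measurable borel"
  unfolding fejer_def[abs_def] by measurable

text \<open>The squared modulus expands into a double sum of exponentials in which only the
  \<open>n\<close> diagonal terms have a nonzero mean; \<open>0 < D\<close> keeps the other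
  frequencies away from 0.\<close>

lemma integral_fejer:
  assumes "0 < D" "0 < n"
  shows "(LINT x|circle_measure. fejer n (real D * x)) = 1 / real n"
proof -
  have "complex_of_real (LINT x|circle_measure. fejer n (real D * x)) =
      (LINT x|circle_measure. complex_of_real (fejer n (real D * x)))"
    by simp
  also have "\<dots> = (LINT x|circle_measure. (\<Sum>l<n. \<Sum>l'<n. ee ((int l - int l') * int D) x * (1 / (of_nat n)\<^sup>2)))"
    unfolding fejer_eq_sum
    by (simp add: sum_product cnj_ee ee_scale left_diff_distrib flip: ee_add sum_divide_distrib)
  also have "\<dots> = (\<Sum>l<n. \<Sum>l'<n. (if l = l' then 1 else 0) * (1 / (of_nat n)\<^sup>2))"
    using assms
    by (simp add: integral_ee integrable_ee Bochner_Integration.integral_sum)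
  also have "\<dots> = complex_of_real (1 / real n)"
    using assms by (simp add: power2_eq_square flip: sum_divide_distrib)
  finally show ?thesis by (simp only: of_real_eq_iff)
qed

text \<open>On this range none of the \<open>n\<close> phases exceeds \<open>pi / 4\<close>, so
  every summand has real part at least \<open>sqrt 2 / 2\<close> and no cancellation occurs.\<close>

lemma fejer_ge_half:
  assumes "frac x < 1 / (8 * real n)" "0 < n"
  shows "1 / 2 \<le> fejer n x"
proof -
  define y where "y = frac x"
  have "fejer n x = fejer n (y + of_int \<lfloor>x\<rfloor>)" by (simp add: y_def frac_def)
  then have xy: "fejer n x = fejer n y" by (simp only: fejer_add_int)
  have y0: "0 \<le> y" "y * (8 * real n) \<le> 1" using assms by (auto simp: y_def field_simps)
  have "sqrt 2 / 2 \<le> cos (2 * pi * real l * y)" if "l < n" for l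
  proof -
    have "(8 * real l) * y \<le> (8 * real n) * y" using that y0 by (intro mult_right_mono) auto
    then have "pi * (8 * real l * y) \<le> pi * 1" using y0 by (intro mult_left_mono) (auto simp: mult_ac)
    then have "2 * pi * real l * y \<le> pi / 4" by (simp add: mult_ac)
    then have "cos (pi / 4) \<le> cos (2 * pi * real l * y)"
      using y0 by (intro cos_monotone_0_pi_le) (auto simp: pi_gt_zero less_imp_le)
    then show ?thesis by (simp add: cos_45)
  qed
  then have "(\<Sum>l<n. sqrt 2 / 2) \<le> (\<Sum>l<n. Re (ee (int l) y))"
    by (intro sum_mono) (simp add: ee_cis)
  then have "real n * (sqrt 2 / 2) \<le> Re (\<Sum>l<n. ee (int l) y)" by simp
  also have "\<dots> \<le> norm (\<Sum>l<n. ee (int l) y)" by (rule complex_Re_le_cmod)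
  finally have "(real n * (sqrt 2 / 2))\<^sup>2 \<le> (norm (\<Sum>l<n. ee (int l) y))\<^sup>2"
    by (intro power_mono) auto
  then show ?thesis
    using assms(2) unfolding xy unfolding fejer_def by (simp add: power_mult_distrib power_divide field_simps)
qed

text \<open>
  A trigonometric polynomial standing in for the indicator function of the event that one of the
  first \<open>S\<close> digits of \<open>x\<close> in base \<open>2 ^ (r + 3)\<close> is zero.
\<close>
definition bump :: "nat \<Rightarrow> nat \<Rightarrow> real \<Rightarrow> real" where
  "bump r S x = 1 - (\<Prod>i<S. 1 - fejer (2 ^ r) (real (2 ^ ((r + 3) * i)) * x))"

lemma bump_nonneg: "0 \<le> bump r S x"
  unfolding bump_def by (simp add: prod_le_1 fejer_nonneg fejer_le_1)

lemma bump_le_1: "bump r S x \<le> 1"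
  unfolding bump_def by (simp add: prod_nonneg fejer_le_1)

lemma borel_measurable_bump [measurable]: "bump r S \<in> borel_measurable borel"
  unfolding bump_def[abs_def] by measurable

lemma trig_poly_bump: "trig_poly (2 ^ ((r + 3) * S)) (\<lambda>x. complex_of_real (bump r S x))"
proof -
  have "trig_poly (2 ^ ((r + 3) * S))
      (\<lambda>x. (\<Prod>i<S. 1 - complex_of_real (fejer (2 ^ r) (real (2 ^ ((r + 3) * i)) * x))))"
  proof (induction S)
    case (Suc S)
    define R where "R = (2::nat) ^ ((r + 3) * S)"
    have "trig_poly (2 * 2 ^ r * R) (\<lambda>x. complex_of_real (fejer (2 ^ r) (real R * x)))"
      by (rule trig_poly_scale[OF trig_poly_fejer])
    then have "trig_poly (2 * 2 ^ r * R) (\<lambda>x. 1 - complex_of_real (fejer (2 ^ r) (real R * x)))"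
      by (intro trig_poly_diff trig_poly_const)
    from trig_poly_mult[OF Suc this[unfolded R_def]]
    have *: "trig_poly (R + 2 * 2 ^ r * R)
      (\<lambda>x. (\<Prod>i<Suc S. 1 - complex_of_real (fejer (2 ^ r) (real (2 ^ ((r + 3) * i)) * x))))"
      by (simp add: R_def)
    \<comment> \<open>The new factor has degree at most \<open>2 * 2 ^ r * R\<close>, where
      \<open>R\<close> bounds the degree so far. One more digit thus multiplies the bound by at most
      \<open>8 * 2 ^ r\<close>, which is the base of the digits.\<close>
    have "R + 2 * 2 ^ r * R \<le> 2 ^ ((r + 3) * Suc S)"
    proof -
      have "1 + 2 * 2 ^ r \<le> 8 * (2::nat) ^ r" by simp
      then have "(1 + 2 * 2 ^ r) * R \<le> 8 * 2 ^ r * R" by (rule mult_right_mono) simp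
      then show ?thesis by (simp add: R_def power_add algebra_simps)
    qed
    from trig_poly_mono[OF * this] show ?case .
  qed (simp add: trig_poly_const)
  then show ?thesis
    unfolding bump_def by (simp add: trig_poly_diff trig_poly_const)
qed

lemma bump_periodic: "bump r S (x + 1) = bump r S x"
  using trig_poly_periodic[OF trig_poly_bump] by simp

text \<open>The Weierstrass product inequality. For \<open>bump\<close> it plays the part of the
  union bound.\<close>

lemma one_minus_sum_le_prod:
  fixes a :: "'i \<Rightarrow> real"
  assumes "\<And>i. i \<in> A \<Longrightarrow> 0 \<le> a i \<and> a i \<le> 1"
  shows "1 - sum a A \<le> (\<Prod>i\<in>A. 1 - a i)"
  using assms
proof (induction A rule: infinite_finite_induct)
  case (insert i A)
  have "a i * (\<Prod>i\<in>A. 1 - a i) \<le> a i * 1"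
    using insert by (intro mult_left_mono prod_le_1) auto
  then show ?case using insert by (simp add: algebra_simps)
qed auto

lemma integral_bump_le:
  assumes "0 < D"
  shows "(LINT x|circle_measure. bump r S (real D * x)) \<le> real S / 2 ^ r"
proof -
  have le: "bump r S y \<le> (\<Sum>i<S. fejer (2 ^ r) (real (2 ^ ((r + 3) * i)) * y))" for y
    using one_minus_sum_le_prod[of "{..<S}" "\<lambda>i. fejer (2 ^ r) (real (2 ^ ((r + 3) * i)) * y)"]
    by (simp add: bump_def fejer_nonneg fejer_le_1)
  have i1: "integrable circle_measure (\<lambda>x. bump r S (real D * x))"
    by (rule integrable_circle_bounded[of _ 1]) (auto simp: bump_nonneg bump_le_1)
  have i2: "integrable circle_measure (\<lambda>x. fejer (2 ^ r) (real (2 ^ ((r + 3) * i) * D) * x))" for i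
    by (rule integrable_circle_bounded[of _ 1]) (auto simp: fejer_nonneg fejer_le_1)
  have "(LINT x|circle_measure. bump r S (real D * x))
      \<le> (LINT x|circle_measure. (\<Sum>i<S. fejer (2 ^ r) (real (2 ^ ((r + 3) * i) * D) * x)))"
    using le by (intro integral_mono i1 Bochner_Integration.integrable_sum i2) (simp add: mult.assoc)
  also have "\<dots> = (\<Sum>i<S. 1 / real (2 ^ r))"
    by (subst Bochner_Integration.integral_sum[OF i2]) (rule sum.cong[OF refl integral_fejer], use assms in auto)
  finally show ?thesis by simp
qed

text \<open>The hypothesis says that digit \<open>i\<close> in base \<open>2 ^ (r + 3)\<close> is
  zero. The number \<open>2 ^ (r + 3)\<close> is the \<open>8 * n\<close> of
  \<open>fejer_ge_half\<close> for \<open>n = 2 ^ r\<close>, and a single factor of at most 1/2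
  already bounds the whole product.\<close>

lemma bump_ge_half:
  assumes "i < S" "frac (2 ^ ((r + 3) * i) * x) < 1 / 2 ^ (r + 3)"
  shows "1 / 2 \<le> bump r S x"
proof -
  define a where "a i = 1 - fejer (2 ^ r) (real (2 ^ ((r + 3) * i)) * x)" for i
  have a: "0 \<le> a i" "a i \<le> 1" for i by (auto simp: a_def fejer_nonneg fejer_le_1)
  have "1 / 2 \<le> fejer (2 ^ r) (real (2 ^ ((r + 3) * i)) * x)"
    using assms(2) by (intro fejer_ge_half) (simp_all add: power_add mult_ac)
  then have "a i \<le> 1 / 2" by (simp add: a_def)
  have "(\<Prod>i<S. a i) = a i * (\<Prod>i\<in>{..<S} - {i}. a i)"
    using assms(1) by (intro prod.remove) auto
  also have "\<dots> \<le> a i * 1" by (intro mult_left_mono prod_le_1) (auto simp: a)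
  finally show ?thesis using \<open>a i \<le> 1 / 2\<close> by (simp add: bump_def a_def)
qed

subsection \<open>Zero digits occur infinitely often\<close>

text \<open>Events on the circle are kept as periodic subsets of the line, so that dilations of
  \<open>x\<close> need no reduction modulo 1.\<close>

definition periodic_borel :: "real set \<Rightarrow> bool" where
  "periodic_borel H \<longleftrightarrow> H \<in> sets borel \<and> (\<forall>x. x + 1 \<in> H \<longleftrightarrow> x \<in> H)"

lemma periodic_borel_add_nat:
  "periodic_borel H \<Longrightarrow> x + real n \<in> H \<longleftrightarrow> x \<in> H"
proof (induction n)
  case (Suc n)
  then have "(x + real n) + 1 \<in> H \<longleftrightarrow> x \<in> H" by (simp add: periodic_borel_def)
  then show ?case by (simp add: add_ac)
qed simp

lemma lmeasurable_Int_Ico: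
  fixes a b :: real
  assumes "H \<in> sets borel" shows "H \<inter> {a..<b} \<in> lmeasurable"
proof -
  have "{a..<b} \<in> lmeasurable"
    by (rule bounded_set_imp_lmeasurable) (auto intro: bounded_subset[OF bounded_closed_interval[of a b]])
  moreover have "H \<inter> {a..<b} \<in> sets lebesgue"
    using assms by (intro sets_completionI_sets) simp
  ultimately show ?thesis by (metis Int_lower2 fmeasurableI2)
qed

lemma measure_periodic_Ico:
  assumes H: "periodic_borel H"
  shows "measure lebesgue (H \<inter> {real a..<real (a + n)}) = real n * measure lebesgue (H \<inter> {0..<1})"
proof (induction n)
  case (Suc n)
  let ?A = "H \<inter> {real a..<real (a + n)}"
  let ?B = "(\<lambda>x. 1 *\<^sub>R x + real (a + n)) ` (H \<inter> {0..<1})"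
  have b: "H \<in> sets borel" using H by (simp add: periodic_borel_def)
  have B: "?B = H \<inter> {real (a + n)..<real (a + n) + 1}"
  proof (intro set_eqI iffI)
    fix y assume "y \<in> H \<inter> {real (a + n)..<real (a + n) + 1}"
    then have "y - real (a + n) \<in> H \<inter> {0..<1}"
      using periodic_borel_add_nat[OF H, of "y - real (a + n)" "a + n"] by auto
    then show "y \<in> ?B" by (rule rev_image_eqI) simp
  qed (use periodic_borel_add_nat[OF H] in \<open>auto simp del: of_nat_add\<close>)
  have "H \<inter> {real a..<real (a + Suc n)} = ?A \<union> ?B"
    unfolding B by auto
  moreover have "?A \<inter> ?B = {}" unfolding B by auto
  moreover have "?A \<in> lmeasurable" "?B \<in> lmeasurable"
    unfolding B by (intro lmeasurable_Int_Ico b)+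
  ultimately have "measure lebesgue (H \<inter> {real a..<real (a + Suc n)})
      = measure lebesgue ?A + measure lebesgue ?B"
    by (simp add: measure_Un3)
  moreover have "measure lebesgue ?B = measure lebesgue (H \<inter> {0..<1})"
    by (subst measure_lebesgue_affine) simp
  ultimately show ?case using Suc by (simp add: algebra_simps)
qed simp

text \<open>Division by \<open>D\<close> carries the part of \<open>H\<close> between
  \<open>a\<close> and \<open>D\<close> onto the event, and that range consists of
  \<open>D - a\<close> full periods. With \<open>a = 0\<close> this is the invariance of the measure
  under dilation; with \<open>a = 1\<close> and \<open>D\<close> the base it is the independence of
  the first digit from the later ones.\<close>

lemma measure_scaled_periodic:
  assumes H: "periodic_borel H" and D: "0 < D" "a \<le> D"
  shows "measure lebesgue ({x. real a / real D \<le> x \<and> real D * x \<in> H} \<inter> {0..<1})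
    = (1 - real a / real D) * measure lebesgue (H \<inter> {0..<1})"
proof -
  have "{x. real a / real D \<le> x \<and> real D * x \<in> H} \<inter> {0..<1}
      = (\<lambda>x. (1 / real D) *\<^sub>R x + 0) ` (H \<inter> {real a..<real D})" (is "?A = ?B")
  proof (intro set_eqI iffI)
    fix x assume "x \<in> ?A"
    then have "real D * x \<in> H \<inter> {real a..<real D}" using D by (auto simp: field_simps)
    then show "x \<in> ?B" by (rule rev_image_eqI) (use D in simp)
  qed (use D in \<open>auto simp: field_simps intro: order.trans[of 0 "real a"]\<close>)
  also have "measure lebesgue \<dots> = (1 / real D) * measure lebesgue (H \<inter> {real a..<real (a + (D - a))})"
    using D by (subst measure_lebesgue_affine) simp
  also have "\<dots> = (1 - real a / real D) * measure lebesgue (H \<inter> {0..<1})"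
    using D by (subst measure_periodic_Ico[OF H]) (simp add: of_nat_diff field_simps)
  finally show ?thesis .
qed

lemma frac_add_one: "frac (x + 1 :: real) = frac x"
  by (simp add: frac_def)

lemma periodic_borel_scaled:
  assumes "periodic_borel H"
  shows "periodic_borel {x. real D * x \<in> H}"
proof -
  have "real D * (x + 1) \<in> H \<longleftrightarrow> real D * x \<in> H" for x
    using periodic_borel_add_nat[OF assms, of "real D * x" D] by (simp add: ring_distribs)
  moreover have "{x. real D * x \<in> H} \<in> sets borel"
    using assms measurable_sets_borel[of "\<lambda>x. real D * x" borel H]
    by (simp add: periodic_borel_def vimage_def)
  ultimately show ?thesis by (simp add: periodic_borel_def)
qed

lemma measure_dilation_periodic:
  assumes "periodic_borel H" "0 < D"
  shows "measure lebesgue ({x. real D * x \<in> H} \<inter> {0..<1}) = measure lebesgue (H \<inter> {0..<1})"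
proof -
  have "{x. real D * x \<in> H} \<inter> {0..<1} = {x. real 0 / real D \<le> x \<and> real D * x \<in> H} \<inter> {0..<1}" by auto
  then show ?thesis using measure_scaled_periodic[OF assms, of 0] by simp
qed

text \<open>
  The digits of \<open>x\<close> in base \<open>2 ^ \<rho>\<close>: the first one is nonzero, and the remaining ones form a
  point of \<open>H\<close>.
\<close>
definition nonzero_digit :: "nat \<Rightarrow> real set \<Rightarrow> real set" where
  "nonzero_digit \<rho> H = {x. 1 / 2 ^ \<rho> \<le> frac x \<and> 2 ^ \<rho> * x \<in> H}"

lemma periodic_borel_nonzero_digit:
  assumes "periodic_borel H" shows "periodic_borel (nonzero_digit \<rho> H)"
proof -
  have s: "periodic_borel {x. 2 ^ \<rho> * x \<in> H}"
    using periodic_borel_scaled[OF assms, of "2 ^ \<rho>"] by simp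
  have eq: "nonzero_digit \<rho> H = {x. 1 / 2 ^ \<rho> \<le> frac x} \<inter> {x. 2 ^ \<rho> * x \<in> H}"
    by (auto simp: nonzero_digit_def)
  have [measurable]: "frac \<in> borel_measurable (borel :: real measure)"
    unfolding frac_def[abs_def] by measurable
  have "{x::real. 1 / 2 ^ \<rho> \<le> frac x} \<in> sets borel" by measurable
  then have "nonzero_digit \<rho> H \<in> sets borel"
    unfolding eq using s by (intro sets.Int) (simp_all add: periodic_borel_def)
  moreover have "x + 1 \<in> nonzero_digit \<rho> H \<longleftrightarrow> x \<in> nonzero_digit \<rho> H" for x
    unfolding eq using s by (simp add: periodic_borel_def frac_add_one)
  ultimately show ?thesis by (simp add: periodic_borel_def)
qed

lemma measure_nonzero_digit:
  assumes "periodic_borel H"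
  shows "measure lebesgue (nonzero_digit \<rho> H \<inter> {0..<1})
    = (1 - 1 / 2 ^ \<rho>) * measure lebesgue (H \<inter> {0..<1})"
proof -
  have "nonzero_digit \<rho> H \<inter> {0..<1}
      = {x. real 1 / real (2 ^ \<rho>) \<le> x \<and> real (2 ^ \<rho>) * x \<in> H} \<inter> {0..<1}"
    by (auto simp: nonzero_digit_def frac_eq[THEN iffD2])
  then show ?thesis using measure_scaled_periodic[OF assms, of "2 ^ \<rho>" 1] by simp
qed

lemma
  assumes "periodic_borel H"
  shows periodic_borel_nonzero_digits: "periodic_borel ((nonzero_digit \<rho> ^^ \<tau>) H)"
    and measure_nonzero_digits: "measure lebesgue ((nonzero_digit \<rho> ^^ \<tau>) H \<inter> {0..<1})
      = (1 - 1 / 2 ^ \<rho>) ^ \<tau> * measure lebesgue (H \<inter> {0..<1})"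
proof (induction \<tau>)
  case (Suc \<tau>)
  { case 1 then show ?case using Suc by (simp add: periodic_borel_nonzero_digit)
  next
    case 2 then show ?case using Suc by (simp add: measure_nonzero_digit)
  }
qed (use assms in auto)

lemma mem_nonzero_digits_iff:
  "x \<in> (nonzero_digit \<rho> ^^ \<tau>) H \<longleftrightarrow>
     (\<forall>i<\<tau>. 1 / 2 ^ \<rho> \<le> frac (2 ^ (\<rho> * i) * x)) \<and> 2 ^ (\<rho> * \<tau>) * x \<in> H"
proof (induction \<tau> arbitrary: x)
  case (Suc \<tau>)
  have "x \<in> (nonzero_digit \<rho> ^^ Suc \<tau>) H \<longleftrightarrow> 1 / 2 ^ \<rho> \<le> frac x \<and> 2 ^ \<rho> * x \<in> (nonzero_digit \<rho> ^^ \<tau>) H"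
    by (simp add: nonzero_digit_def)
  also have "\<dots> \<longleftrightarrow> 1 / 2 ^ \<rho> \<le> frac x \<and>
     (\<forall>i<\<tau>. 1 / 2 ^ \<rho> \<le> frac (2 ^ (\<rho> * Suc i) * x)) \<and> 2 ^ (\<rho> * Suc \<tau>) * x \<in> H"
    unfolding Suc by (simp add: power_add mult_ac)
  also have "\<dots> \<longleftrightarrow> (\<forall>i<Suc \<tau>. 1 / 2 ^ \<rho> \<le> frac (2 ^ (\<rho> * i) * x)) \<and> 2 ^ (\<rho> * Suc \<tau>) * x \<in> H"
    unfolding All_less_Suc2 by simp
  finally show ?case .
qed simp

section \<open>Independent blocks of digits and a Borel-Cantelli argument\<close>

context
  fixes \<rho> \<tau> e :: "nat \<Rightarrow> nat"
  assumes e_Suc: "\<And>m. e (Suc m) = e m + \<rho> m * (2 * \<tau> m)"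
begin

text \<open>Block \<open>m\<close> occupies \<open>2 * \<tau> m\<close> digits of
  \<open>\<rho> m\<close> bits each, from the binary position \<open>e m\<close> on, and the set
  lives on the point \<open>2 ^ e m * x\<close>. It expresses that none of \<open>L\<close>
  successive blocks has a zero digit in its second half. Since the later blocks enter as the set
  \<open>H\<close> of \<open>measure_nonzero_digits\<close>, independence of the blocks reduces to
  iterating that lemma.\<close>

primrec avoiding :: "nat \<Rightarrow> nat \<Rightarrow> real set" where
  "avoiding 0 m = UNIV"
| "avoiding (Suc L) m =
     {x. real (2 ^ (\<rho> m * \<tau> m)) * x \<in> (nonzero_digit (\<rho> m) ^^ \<tau> m) (avoiding L (Suc m))}"

lemma periodic_borel_avoiding: "periodic_borel (avoiding L m)"
proof (induction L arbitrary: m)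
  case 0 show ?case by (simp add: periodic_borel_def)
next
  case (Suc L) then show ?case
    unfolding avoiding.simps by (intro periodic_borel_scaled periodic_borel_nonzero_digits)
qed

lemma measure_avoiding:
  "measure lebesgue (avoiding L m \<inter> {0..<1}) = (\<Prod>i<L. (1 - 1 / 2 ^ \<rho> (i + m)) ^ \<tau> (i + m))"
proof (induction L arbitrary: m)
  case (Suc L)
  have "measure lebesgue (avoiding (Suc L) m \<inter> {0..<1})
      = (1 - 1 / 2 ^ \<rho> m) ^ \<tau> m * (\<Prod>i<L. (1 - 1 / 2 ^ \<rho> (Suc i + m)) ^ \<tau> (Suc i + m))"
    unfolding avoiding.simps
    by (subst measure_dilation_periodic)
      (simp_all add: periodic_borel_nonzero_digits periodic_borel_avoiding measure_nonzero_digits Suc)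
  then show ?case by (simp only: prod.lessThan_Suc_shift) simp
qed simp

lemma mem_avoiding:
  assumes "\<And>m' i. m \<le> m' \<Longrightarrow> i < \<tau> m' \<Longrightarrow> 1 / 2 ^ \<rho> m' \<le> frac (2 ^ (e m' + \<rho> m' * (\<tau> m' + i)) * x)"
  shows "2 ^ e m * x \<in> avoiding L m"
  using assms
proof (induction L arbitrary: m)
  case (Suc L)
  have "2 ^ e (Suc m) * x \<in> avoiding L (Suc m)" using Suc.prems by (intro Suc.IH) auto
  moreover have "1 / 2 ^ \<rho> m \<le> frac (2 ^ (\<rho> m * i) * (2 ^ (\<rho> m * \<tau> m) * (2 ^ e m * x)))" if "i < \<tau> m" for i
    using Suc.prems[of m i] that by (simp add: ring_distribs power_add mult_ac)
  ultimately show ?case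
    by (simp add: mem_nonzero_digits_iff e_Suc power_add mult_2 mult_2_right ring_distribs mult_ac)
qed simp

text \<open>The second Borel-Cantelli lemma, proved directly: the chance that no block from
  \<open>m\<close> on has a zero digit in its second half is at most a product of factors
  \<open>(1 - 1 / 2 ^ \<rho> i) ^ \<tau> i\<close>. Each is at most
  \<open>exp (- \<tau> i / 2 ^ \<rho> i)\<close>, so divergence of the sum drives the product to
  0.\<close>

lemma AE_infinitely_often_zero_digit:
  assumes "\<not> summable (\<lambda>m. real (\<tau> m) / 2 ^ \<rho> m)"
  shows "AE x in circle_measure. \<forall>m. \<exists>m'\<ge>m. \<exists>i<\<tau> m'. frac (2 ^ (e m' + \<rho> m' * (\<tau> m' + i)) * x) < 1 / 2 ^ \<rho> m'"
proof -
  have "AE x in circle_measure. \<exists>m'\<ge>m. \<exists>i<\<tau> m'. frac (2 ^ (e m' + \<rho> m' * (\<tau> m' + i)) * x) < 1 / 2 ^ \<rho> m'" for m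
  proof -
    define U where "U L = {x. real (2 ^ e m) * x \<in> avoiding L m} \<inter> {0..<1}" for L
    define I where "I = (\<Inter>L. U L)"
    have U: "U L \<in> lmeasurable" for L
      unfolding U_def using periodic_borel_scaled[OF periodic_borel_avoiding[of L m], of "2 ^ e m"]
      by (intro lmeasurable_Int_Ico) (simp add: periodic_borel_def)
    have Im: "I \<in> lmeasurable"
    proof (rule fmeasurableI2[OF U[of 0]])
      show "I \<in> sets lebesgue" unfolding I_def using U by (intro sets.countable_INT) auto
    qed (auto simp: I_def)
    have "measure lebesgue I < \<epsilon>" if "0 < \<epsilon>" for \<epsilon>
    proof -
      define a where "a i = real (\<tau> (i + m)) / 2 ^ \<rho> (i + m)" for i
      have "\<not> summable a" using assms summable_iff_shift[of "\<lambda>m. real (\<tau> m) / 2 ^ \<rho> m" m] by (simp add: a_def[abs_def])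
      then have "\<not> (\<forall>L. (\<Sum>i<L. a i) \<le> - ln \<epsilon>)"
        using summableI_nonneg_bounded[of a "- ln \<epsilon>"] by (auto simp: a_def)
      then obtain L where L: "- ln \<epsilon> < (\<Sum>i<L. a i)" by (auto simp: not_le)
      have "measure lebesgue I \<le> measure lebesgue (U L)"
        using U Im by (intro measure_mono_fmeasurable) (auto simp: I_def)
      also have "\<dots> = (\<Prod>i<L. (1 - 1 / 2 ^ \<rho> (i + m)) ^ \<tau> (i + m))"
        unfolding U_def by (simp only: measure_dilation_periodic periodic_borel_avoiding zero_less_power
            zero_less_numeral measure_avoiding)
      also have "\<dots> \<le> (\<Prod>i<L. exp (- a i))"
      proof (intro prod_mono conjI)
        fix i
        have "1 - 1 / (2::real) ^ \<rho> (i + m) \<le> exp (- (1 / 2 ^ \<rho> (i + m)))"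
          using exp_ge_add_one_self[of "- (1 / 2 ^ \<rho> (i + m))"] by simp
        then have "(1 - 1 / (2::real) ^ \<rho> (i + m)) ^ \<tau> (i + m) \<le> exp (- (1 / 2 ^ \<rho> (i + m))) ^ \<tau> (i + m)"
          by (intro power_mono) auto
        then show "(1 - 1 / (2::real) ^ \<rho> (i + m)) ^ \<tau> (i + m) \<le> exp (- a i)"
          by (simp add: a_def flip: exp_of_nat_mult)
      qed auto
      also have "\<dots> = exp (- (\<Sum>i<L. a i))" by (simp add: exp_sum sum_negf[symmetric])
      also have "\<dots> < exp (ln \<epsilon>)" using L by (simp only: exp_less_cancel_iff)
      finally show ?thesis using that by simp
    qed
    then have "\<not> 0 < measure lebesgue I" by blast
    then have "measure lebesgue I = 0" by (simp add: zero_less_measure_iff)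
    then have "negligible I" using Im by (simp only: negligible_iff_measure simp_thms)
    then have "I \<in> null_sets lebesgue" by (simp only: negligible_iff_null_sets)
    then have "AE x in lebesgue. x \<notin> I" by (rule AE_not_in)
    then have "AE x in circle_measure. x \<notin> I"
      unfolding circle_measure_def by (subst AE_restrict_space_iff) auto
    moreover have "AE x in circle_measure. x \<in> {0..<1}"
      using AE_space[of circle_measure] by simp
    ultimately show ?thesis
    proof eventually_elim
      case (elim x)
      show ?case
      proof (rule ccontr)
        assume neg: "\<not> ?thesis"
        have "2 ^ e m * x \<in> avoiding L m" for L
          using neg by (intro mem_avoiding) (meson not_less)
        then show False using elim by (simp add: I_def U_def)
      qed
    qed
  qed
  then show ?thesis by (simp add: AE_all_countable)
qed

end

subsection \<open>The function and the dilations\<close>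

text \<open>
  The mean of layer \<open>k\<close> before scaling is about \<open>windows k / 2 ^ width k = 2 ^ - (k + lam k)\<close>, so that
  its squared norm after scaling is about \<open>2 ^ - k\<close>. The value of \<open>lam k\<close> is chosen so that
  \<open>height k\<close> is unbounded although the sum of \<open>2 ^ - lam k\<close> diverges.
\<close>
definition lam :: "nat \<Rightarrow> nat" where "lam k = floor_log (k + 1)"
definition windows :: "nat \<Rightarrow> nat" where "windows k = 2 ^ 2 ^ (k + 1)"
definition width :: "nat \<Rightarrow> nat" where "width k = 2 ^ (k + 1) + k + lam k"
definition height :: "nat \<Rightarrow> real" where "height k = sqrt (2 ^ lam k)"
definition layer :: "nat \<Rightarrow> real \<Rightarrow> real" where
  "layer k x = height k * bump (width k) (2 * windows k) x"

section \<open>Size, degree and moments of the layers\<close>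

lemma two_power_lam_le: "2 ^ lam k \<le> k + 1"
  unfolding lam_def by (rule floor_log_exp2_le) simp

lemma lam_le: "lam k \<le> k"
  using two_power_lam_le[of k] less_exp[of "lam k"] by linarith

lemma height_pos: "0 < height k" by (simp add: height_def)

lemma height_sq: "(height k)\<^sup>2 = 2 ^ lam k" by (simp add: height_def)

lemma height_le: "height k \<le> sqrt (real k + 1)"
proof -
  have "real (2 ^ lam k) \<le> real (k + 1)" using two_power_lam_le[of k] by (simp only: of_nat_le_iff)
  then show ?thesis by (simp add: height_def)
qed

lemma height_ge: "sqrt ((real k + 1) / 2) \<le> height k"
proof -
  have "k + 1 \<le> 2 * 2 ^ lam k" unfolding lam_def by (rule floor_log_exp2_ge)
  then have "real (k + 1) \<le> real (2 * 2 ^ lam k)" by (simp only: of_nat_le_iff)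
  then show ?thesis by (simp add: height_def)
qed

lemma layer_nonneg: "0 \<le> layer k x"
  by (simp add: layer_def height_def bump_nonneg)

lemma layer_le: "layer k x \<le> height k"
  using bump_le_1[of "width k" "2 * windows k" x] height_pos[of k]
  by (simp add: layer_def mult_left_le less_imp_le)

lemma borel_measurable_layer [measurable]: "layer k \<in> borel_measurable borel"
  unfolding layer_def[abs_def] by measurable

lemma layer_periodic: "layer k (x + 1) = layer k x"
  by (simp add: layer_def bump_periodic)

text \<open>The exponent of the degree is the number of bits read,
  \<open>(width k + 3) * (2 * windows k)\<close>, which is dominated by the doubly exponential
  \<open>windows k\<close>. The third exponential comes from passing from bits to
  frequencies.\<close>

lemma trig_poly_layer: "trig_poly (2 ^ 2 ^ 2 ^ (k + 3)) (\<lambda>x. complex_of_real (layer k x))"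
proof -
  have k: "k + 1 \<le> (2::nat) ^ k" using less_exp[of k] by linarith
  have "width k + 3 \<le> 2 ^ (k + 1) + 2 * k + 3" using lam_le[of k] by (simp add: width_def)
  also have "\<dots> \<le> 2 ^ (k + 3)" using k by (simp add: power_add)
  finally have "(width k + 3) * (2 * windows k) \<le> 2 ^ (k + 3) * (2 * windows k)"
    by (rule mult_right_mono) simp
  also have "\<dots> = 2 ^ (k + 4 + 2 ^ (k + 1))" by (simp add: windows_def power_add)
  also have "\<dots> \<le> 2 ^ 2 ^ (k + 3)"
    using k by (intro power_increasing) (simp_all add: power_add)
  finally have "(2::nat) ^ ((width k + 3) * (2 * windows k)) \<le> 2 ^ 2 ^ 2 ^ (k + 3)"
    by (intro power_increasing) auto
  from trig_poly_mono[OF trig_poly_bump this] show ?thesis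
    unfolding layer_def by (simp add: trig_poly_cmult)
qed

text \<open>Since \<open>bump\<close> takes values between 0 and 1 and \<open>1 \<le> p\<close>, its
  \<open>p\<close>-th power is at most \<open>bump\<close> itself; hence all moments are controlled
  by the mean \<open>2 * windows k / 2 ^ width k\<close>.\<close>

lemma
  assumes "0 < D" "1 \<le> p"
  shows integrable_layer_powr: "integrable circle_measure (\<lambda>x. layer k (real D * x) powr p)"
    and integral_layer_powr_le:
      "(LINT x|circle_measure. layer k (real D * x) powr p) \<le> 2 * height k powr p / 2 ^ (k + lam k)"
proof -
  let ?b = "\<lambda>x. bump (width k) (2 * windows k) (real D * x)"
  show i: "integrable circle_measure (\<lambda>x. layer k (real D * x) powr p)"
    using assms layer_nonneg layer_le
    by (intro integrable_circle_bounded[of _ "height k powr p"]) (auto intro!: powr_mono2)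
  have ib: "integrable circle_measure ?b"
    by (rule integrable_circle_bounded[of _ 1]) (auto simp: bump_nonneg bump_le_1)
  have "layer k y powr p \<le> height k powr p * bump (width k) (2 * windows k) y" for y
  proof -
    have "bump (width k) (2 * windows k) y powr p \<le> bump (width k) (2 * windows k) y powr 1"
      using assms by (intro powr_mono') (auto simp: bump_nonneg bump_le_1)
    then show ?thesis
      using height_pos[of k] bump_nonneg
      by (simp add: layer_def powr_mult mult_left_mono less_imp_le)
  qed
  then have "(LINT x|circle_measure. layer k (real D * x) powr p)
      \<le> (LINT x|circle_measure. height k powr p * ?b x)"
    using ib by (intro integral_mono i) auto
  also have "\<dots> \<le> height k powr p * (real (2 * windows k) / 2 ^ width k)"
    using integral_bump_le[OF assms(1), of "width k" "2 * windows k"]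
    by (simp del: times_divide_eq_right) (intro mult_left_mono, simp_all)
  also have "\<dots> = 2 * height k powr p / 2 ^ (k + lam k)"
    by (simp add: windows_def width_def power_add)
  finally show "(LINT x|circle_measure. layer k (real D * x) powr p) \<le> 2 * height k powr p / 2 ^ (k + lam k)" .
qed

lemma
  assumes "0 < D" "1 \<le> p"
  shows AE_summable_layer: "AE x in circle_measure. summable (\<lambda>k. layer k (real D * x))"
    and integrable_suminf_layer_powr:
      "integrable circle_measure (\<lambda>x. (\<Sum>k. layer k (real D * x)) powr p)"
proof -
  \<comment> \<open>The \<open>p\<close>-th moment of layer \<open>k\<close> is at most polynomial
    in \<open>k\<close> times \<open>2 ^ - k\<close>. This choice gives
    \<open>(b ^ k) powr p\<close> one half of the geometric decay; the other half stays in
    \<open>c\<close> and absorbs the polynomial factor.\<close>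
  define b where "b = 2 powr (- 1 / (2 * p))"
  define c where "c k = 2 * (real k + 1) powr (p / 2) * 2 powr (- real k / 2)" for k
  have b: "0 < b" "b < 1" using assms by (auto simp: b_def intro: powr_less_one)
  have c: "summable c"
  proof (rule summable_comparison_test_bigo)
    show "summable (\<lambda>k. norm ((2 powr (- 1 / 4)) ^ k :: real))"
      by (simp add: norm_power summable_geometric_iff powr_less_one)
    show "c \<in> O(\<lambda>k. (2 powr (- 1 / 4)) ^ k)"
      unfolding c_def by real_asymp
  qed
  have le: "(LINT x|circle_measure. layer k (real D * x) powr p) \<le> (b ^ k) powr p * c k" for k
  proof -
    have "height k powr p \<le> sqrt (real k + 1) powr p"
      using assms height_le[of k] height_pos[of k] by (intro powr_mono2) auto
    also have "\<dots> = (real k + 1) powr (p / 2)" by (simp add: powr_powr flip: powr_half_sqrt)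
    finally have h: "height k powr p \<le> (real k + 1) powr (p / 2)" .
    have "2 * height k powr p / 2 ^ (k + lam k) \<le> 2 * (real k + 1) powr (p / 2) / 2 ^ k"
      using h by (intro frac_le) (auto simp: power_increasing)
    also have "2 ^ k = 2 powr (real k)" by (simp add: powr_realpow)
    also have "2 * (real k + 1) powr (p / 2) / 2 powr (real k) = (b ^ k) powr p * c k"
    proof -
      have "(b ^ k) powr p = 2 powr (- 1 / (2 * p) * real k * p)"
        using b by (simp add: b_def powr_powr flip: powr_realpow)
      also have "- 1 / (2 * p) * real k * p = - real k / 2" using assms by simp
      finally have "(b ^ k) powr p * c k = 2 * (real k + 1) powr (p / 2) * (2 powr (- real k / 2) * 2 powr (- real k / 2))"
        by (simp add: c_def mult_ac)
      also have "2 powr (- real k / 2) * 2 powr (- real k / 2) = 1 / 2 powr (real k)"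
        by (simp add: powr_minus_divide flip: powr_add)
      finally show ?thesis by simp
    qed
    finally show ?thesis using integral_layer_powr_le[OF assms, of k] by linarith
  qed
  have m: "(\<lambda>x. layer k (real D * x)) \<in> borel_measurable circle_measure" for k
    by (rule borel_measurable_circle_measure) measurable
  have w: "summable (\<lambda>k. b ^ k)" "\<And>k. 0 < b ^ k" using b by auto
  show "AE x in circle_measure. summable (\<lambda>k. layer k (real D * x))"
    by (rule AE_summable_powr[OF m layer_nonneg integrable_layer_powr[OF assms] le w c assms(2)])
  show "integrable circle_measure (\<lambda>x. (\<Sum>k. layer k (real D * x)) powr p)"
    by (rule integrable_suminf_powr[OF m layer_nonneg integrable_layer_powr[OF assms] le w c assms(2)])
qed

lemma integral_layer_tail_le:
  obtains C where "0 < C"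
    "\<And>K. (LINT x|circle_measure. (\<Sum>k. layer (k + K) x)\<^sup>2) \<le> C / 2 ^ K"
proof
  \<comment> \<open>With \<open>a ^ 4 = 1 / 2\<close> the bound \<open>2 / 2 ^ k\<close> for the
    squared norm of layer \<open>k\<close> splits evenly between the squared weight
    \<open>a ^ (2 * k)\<close> and the coefficient \<open>2 * a ^ (2 * k)\<close>. Both series start
    at \<open>K\<close>, so together they return the full factor \<open>2 ^ - K\<close> and only a
    constant is lost.\<close>
  define a :: real where "a = sqrt (sqrt (1 / 2))"
  have a: "0 < a" "a < 1" by (auto simp: a_def)
  have "a ^ 4 = (a\<^sup>2)\<^sup>2" by simp
  also have "\<dots> = 1 / 2" unfolding a_def by (simp only: real_sqrt_pow2 real_sqrt_ge_0_iff)
  finally have a4: "a ^ 4 = 1 / 2" .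
  have a2: "a\<^sup>2 < 1" using a by (simp add: power_less_one_iff)
  define C where "C = (1 / (1 - a))\<^sup>2 * (2 / (1 - a\<^sup>2))"
  show "0 < C" using a a2 by (simp add: C_def)
  show "(LINT x|circle_measure. (\<Sum>k. layer (k + K) x)\<^sup>2) \<le> C / 2 ^ K" for K
  proof -
    have le: "(LINT x|circle_measure. layer (k + K) x powr 2) \<le> (a ^ (k + K)) powr 2 * (2 * (a\<^sup>2) ^ (k + K))" for k
    proof -
      have "(LINT x|circle_measure. layer (k + K) x powr 2) \<le> 2 / 2 ^ (k + K)"
        using integral_layer_powr_le[of 1 2 "k + K"] height_sq[of "k + K"] height_pos[of "k + K"]
        by (simp add: power_add)
      also have "\<dots> = 2 * (a ^ 4) ^ (k + K)" unfolding a4 by (simp add: power_one_over)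
      also have "\<dots> = (a ^ (k + K)) powr 2 * (2 * (a\<^sup>2) ^ (k + K))"
        using a by (simp add: power_mult[symmetric] power_add[symmetric] algebra_simps)
      finally show ?thesis .
    qed
    have m: "(\<lambda>x. layer (k + K) x) \<in> borel_measurable circle_measure" for k
      by (rule borel_measurable_circle_measure) measurable
    have i: "integrable circle_measure (\<lambda>x. layer (k + K) x powr 2)" for k
      using integrable_layer_powr[of 1 2] by simp
    have w: "(\<lambda>k. a ^ (k + K)) sums (a ^ K / (1 - a))"
      using sums_mult[OF geometric_sums[of a], of "a ^ K"] a by (simp add: power_add mult_ac)
    have c: "(\<lambda>k. 2 * (a\<^sup>2) ^ (k + K)) sums (2 * (a\<^sup>2) ^ K / (1 - a\<^sup>2))"
      using sums_mult[OF geometric_sums[of "a\<^sup>2"], of "2 * (a\<^sup>2) ^ K"] a a2 by (simp add: power_add mult_ac)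
    have pw: "(\<Sum>k. layer (k + K) x) powr 2 = (\<Sum>k. layer (k + K) x)\<^sup>2"
      if "summable (\<lambda>k. layer k x)" for x
      using suminf_nonneg[OF summable_ignore_initial_segment[OF that, of K]] layer_nonneg by simp
    have [measurable]: "layer k \<in> borel_measurable circle_measure" for k
      by (rule borel_measurable_circle_measure) measurable
    have "(LINT x|circle_measure. (\<Sum>k. layer (k + K) x)\<^sup>2) = (LINT x|circle_measure. (\<Sum>k. layer (k + K) x) powr 2)"
      using AE_summable_layer[of 1 1] by (intro integral_cong_AE) (auto simp: pw)
    also have "\<dots> \<le> (\<Sum>k. a ^ (k + K)) powr 2 * (\<Sum>k. 2 * (a\<^sup>2) ^ (k + K))"
      by (rule integral_suminf_powr_le[OF m layer_nonneg i le sums_summable[OF w] _ sums_summable[OF c]]) (use a in auto)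
    also have "\<dots> = C * (a ^ 4) ^ K"
    proof -
      have "(a ^ K / (1 - a)) powr 2 = (1 / (1 - a))\<^sup>2 * (a\<^sup>2) ^ K"
        using a by (simp add: power_divide power_commutes flip: power_mult) (simp add: mult.commute)
      moreover have "(a ^ 4) ^ K = (a\<^sup>2) ^ K * (a\<^sup>2) ^ K"
        by (subst power_mult_distrib[symmetric]) (simp flip: power_add)
      ultimately show ?thesis
        unfolding sums_unique[OF w, symmetric] sums_unique[OF c, symmetric] C_def
        by (simp only: times_divide_eq_right times_divide_eq_left mult_ac)
    qed
    finally show ?thesis unfolding a4 by (simp add: power_one_over)
  qed
qed

text \<open>
  Block \<open>m\<close> consists of the indices \<open>2 ^ m \<le> j < 2 ^ (m + 1)\<close>. It is devoted to layer
  \<open>floor_log m\<close>, so every layer \<open>k\<close> serves \<open>2 ^ k\<close> blocks. Inside a block consecutive dilations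
  shift the base by one digit, and \<open>start\<close> keeps the digits read by different blocks disjoint.
\<close>
definition digits :: "nat \<Rightarrow> nat" where "digits m = width (floor_log m) + 3"
definition reps :: "nat \<Rightarrow> nat" where "reps m = windows (floor_log m)"

primrec start :: "nat \<Rightarrow> nat" where
  "start 0 = 0"
| "start (Suc m) = start m + digits m * (2 * reps m)"

definition dilation :: "nat \<Rightarrow> nat" where
  "dilation j = 2 ^ (start (floor_log j) + digits (floor_log j) * (j - 2 ^ floor_log j))"

text \<open>Block \<open>m\<close> contains \<open>2 ^ m\<close> dilations, so the shifts inside it
  never use more than half of the \<open>2 * reps m\<close> digits available.\<close>

lemma two_power_le_reps: "2 ^ m \<le> reps m"
proof -
  have "m \<le> 2 ^ (floor_log m + 1)" using floor_log_exp2_ge[of m] by simp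
  then show ?thesis unfolding reps_def windows_def by (intro power_increasing) auto
qed

lemma dilation_pos: "0 < dilation j"
  by (simp add: dilation_def)

lemma dilation_Suc:
  assumes "1 \<le> j" shows "2 * dilation j \<le> dilation (j + 1)"
proof -
  define m where "m = floor_log j"
  have j: "2 ^ m \<le> j" "j < 2 * 2 ^ m"
    using assms floor_log_exp2_le[of j] floor_log_exp2_gt[of j] by (auto simp: m_def)
  have d: "1 \<le> digits m" by (simp add: digits_def)
  have exp_le: "1 + (start m + digits m * (j - 2 ^ m)) \<le>
      start (floor_log (j + 1)) + digits (floor_log (j + 1)) * (j + 1 - 2 ^ floor_log (j + 1))"
  \<comment> \<open>At the last index of a block the exponent jumps to \<open>start (Suc m)\<close>,
    which lies beyond every shift of block \<open>m\<close>. Elsewhere it grows by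
    \<open>digits m\<close>, which is at least 1.\<close>
  proof (cases "j + 1 = 2 ^ Suc m")
    case True
    have "digits m * (j - 2 ^ m) + 1 \<le> digits m * (j - 2 ^ m) + digits m" using d by simp
    also have "\<dots> = digits m * (j - 2 ^ m + 1)" by simp
    also have "\<dots> \<le> digits m * (2 * reps m)"
      using j two_power_le_reps[of m] by (intro mult_left_mono) linarith+
    finally show ?thesis unfolding True by (simp only: floor_log_power start.simps)
  next
    case False
    then have "floor_log (j + 1) = m"
      using floor_log_eqI[of "j + 1" m] j by simp
    then show ?thesis using d j by (simp add: Suc_diff_le)
  qed
  have "2 * dilation j = 2 ^ (1 + (start m + digits m * (j - 2 ^ m)))"
    by (simp add: dilation_def m_def)
  also have "\<dots> \<le> dilation (j + 1)"
    unfolding dilation_def by (intro power_increasing exp_le) simp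
  finally show ?thesis .
qed

text \<open>The \<open>2 ^ k\<close> blocks devoted to layer \<open>k\<close> contribute
  \<open>1 / 2 ^ (k + lam k + 3)\<close> each, in total \<open>2 ^ - lam k / 8\<close>. As
  \<open>2 ^ lam k \<le> k + 1\<close>, Cauchy condensation leads to the harmonic series.\<close>

lemma not_summable_reps: "\<not> summable (\<lambda>m. real (reps m) / 2 ^ digits m)"
proof
  define q where "q m = floor_log m + lam (floor_log m) + 3" for m
  have eq: "real (reps m) / 2 ^ digits m = 1 / 2 ^ q m" for m
    by (simp add: reps_def digits_def windows_def width_def q_def power_add)
  have mono: "q m \<le> q (Suc m)" for m
    unfolding q_def lam_def by (intro add_mono floor_log_le_iff) auto
  assume "summable (\<lambda>m. real (reps m) / 2 ^ digits m)"
  then have "summable (\<lambda>k. 2 ^ k * (1 / 2 ^ q (2 ^ k)) :: real)"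
    unfolding eq
    by (subst (asm) condensation_test) (auto intro!: divide_left_mono power_increasing mono)
  then have "summable (\<lambda>k. 1 / 8 * (1 / real (Suc k)))"
  proof (rule summable_comparison_test'[of _ 0])
    fix k
    have "real (2 ^ lam k) \<le> real (k + 1)" using two_power_lam_le[of k] by (simp only: of_nat_le_iff)
    then have "1 / (8 * real (Suc k)) \<le> 1 / (8 * 2 ^ lam k)" by (intro divide_left_mono) auto
    then show "norm (1 / 8 * (1 / real (Suc k))) \<le> 2 ^ k * (1 / 2 ^ q (2 ^ k))"
      by (simp add: q_def power_add mult_ac)
  qed
  then have "summable (\<lambda>k. 1 / real (Suc k))"
    by (subst (asm) summable_cmult_iff) simp
  then show False
    using not_summable_harmonic[where 'a=real] summable_Suc_iff[of "\<lambda>k. 1 / real k"] by (simp add: inverse_eq_divide)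
qed

section \<open>The sum of the layers and its integrability\<close>

definition tower :: "real \<Rightarrow> real" where "tower x = (\<Sum>k. layer k x)"
definition mean where "mean = (LINT x|circle_measure. tower x)"

lemma tower_periodic: "tower (x + 1) = tower x"
  by (simp add: tower_def layer_periodic)

lemma borel_measurable_tower [measurable]: "tower \<in> borel_measurable borel"
  unfolding tower_def[abs_def] by measurable

text \<open>The restriction to almost every point matters: where the series diverges, the value of
  the infinite sum is unspecified.\<close>

lemma AE_tower_nonneg: "AE x in circle_measure. 0 \<le> tower x"
  using AE_summable_layer[of 1 1]
  by (auto elim!: eventually_mono simp: tower_def intro: suminf_nonneg layer_nonneg)

lemma integrable_tower_powr: "1 \<le> p \<Longrightarrow> integrable circle_measure (\<lambda>x. tower x powr p)"
  using integrable_suminf_layer_powr[of 1 p] by (simp add: tower_def)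

lemma integrable_tower: "integrable circle_measure tower"
proof -
  have [measurable]: "tower \<in> borel_measurable circle_measure"
    by (rule borel_measurable_circle_measure) measurable
  have "AE x in circle_measure. tower x powr 1 = tower x"
    using AE_tower_nonneg by eventually_elim simp
  then have "integrable circle_measure (\<lambda>x. tower x powr 1) \<longleftrightarrow> integrable circle_measure tower"
    by (intro integrable_cong_AE) measurable
  then show ?thesis using integrable_tower_powr[of 1] by blast
qed

lemma mean_nonneg: "0 \<le> mean"
  unfolding mean_def by (rule integral_nonneg_AE[OF AE_tower_nonneg])

lemma tower_Lp:
  assumes "1 \<le> p" shows "(\<lambda>x. tower x - mean) \<in> Lp_circle p"
proof -
  have [measurable]: "tower \<in> borel_measurable circle_measure"
    by (rule borel_measurable_circle_measure) measurable
  have le: "norm (y - mean) powr p \<le> 2 powr p * (y powr p + mean powr p)" if "0 \<le> y" for y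
  proof -
    have "norm (y - mean) \<le> 2 * max y mean" using that mean_nonneg by auto
    then have "norm (y - mean) powr p \<le> (2 * max y mean) powr p"
      using assms by (intro powr_mono2) auto
    also have "\<dots> = 2 powr p * max y mean powr p" using that by (simp add: powr_mult)
    also have "max y mean powr p \<le> y powr p + mean powr p" by (simp add: max_def)
    finally show ?thesis by simp
  qed
  have i: "integrable circle_measure (\<lambda>x. 2 powr p * (tower x powr p + mean powr p))"
    using integrable_tower_powr[OF assms] by simp
  have "AE x in circle_measure. norm (norm (tower x - mean) powr p) \<le> norm (2 powr p * (tower x powr p + mean powr p))"
    using AE_tower_nonneg by eventually_elim (use le in \<open>simp add: abs_of_nonneg\<close>)
  then have "integrable circle_measure (\<lambda>x. norm (tower x - mean) powr p)"
    by (intro Bochner_Integration.integrable_bound[OF i]) measurable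
  then show ?thesis by (simp add: Lp_circle_def tower_periodic)
qed

lemma integral_tower_minus_mean: "(LINT x|circle_measure. tower x - mean) = 0"
  using integrable_tower by (simp add: mean_def)

subsection \<open>Speed of $L^2$ approximation and divergence of the averages\<close>

text \<open>If the first \<open>K\<close> layers have degree at most \<open>N\<close>, their sum
  minus the mean is an admissible competitor in the best approximation, and what remains is exactly
  the tail of the series.\<close>

lemma L2_tower_tail:
  obtains C where "0 < C"
    "\<And>K N. (\<And>k. k < K \<Longrightarrow> 2 ^ 2 ^ 2 ^ (k + 3) \<le> N) \<Longrightarrow>
      L2_norm_circle (\<lambda>x. complex_of_real (tower x - mean)
          - fourier_partial_sum N (\<lambda>y. complex_of_real (tower y - mean)) x) \<le> sqrt (C / 2 ^ K)"
proof -
  obtain C where C: "0 < C"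
    "\<And>K. (LINT x|circle_measure. (\<Sum>k. layer (k + K) x)\<^sup>2) \<le> C / 2 ^ K"
    using integral_layer_tail_le by blast
  have "L2_norm_circle (\<lambda>x. complex_of_real (tower x - mean)
          - fourier_partial_sum N (\<lambda>y. complex_of_real (tower y - mean)) x) \<le> sqrt (C / 2 ^ K)"
    if N: "\<And>k. k < K \<Longrightarrow> 2 ^ 2 ^ 2 ^ (k + 3) \<le> N" for K N
  proof -
    have [measurable]: "tower \<in> borel_measurable circle_measure" "layer k \<in> borel_measurable circle_measure" for k
      by (rule borel_measurable_circle_measure, measurable)+
    define P where "P x = (\<Sum>k<K. complex_of_real (layer k x)) - complex_of_real mean" for x
    have P: "trig_poly N P"
      unfolding P_def[abs_def]
      by (intro trig_poly_diff trig_poly_sum trig_poly_const trig_poly_mono[OF trig_poly_layer N]) auto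
    have "L2_norm_circle (\<lambda>x. complex_of_real (tower x - mean)
          - fourier_partial_sum N (\<lambda>y. complex_of_real (tower y - mean)) x)
       \<le> L2_norm_circle (\<lambda>x. complex_of_real (tower x - mean) - P x)"
    proof (rule L2_norm_diff_fourier_partial_sum_le[OF _ _ P])
      show "integrable circle_measure (\<lambda>x. (norm (complex_of_real (tower x - mean)))\<^sup>2)"
        using tower_Lp[of 2] by (simp add: Lp_circle_def flip: of_real_diff)
    qed measurable
    also have "\<dots> = sqrt (LINT x|circle_measure. (\<Sum>k. layer (k + K) x)\<^sup>2)"
    proof -
      have [measurable]: "P \<in> borel_measurable circle_measure"
        by (intro borel_measurable_circle_measure borel_measurable_trig_poly[OF P])
      have eq: "(norm (complex_of_real (tower x - mean) - P x))\<^sup>2 = (\<Sum>k. layer (k + K) x)\<^sup>2"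
        if "summable (\<lambda>k. layer k x)" for x
      proof -
        have "complex_of_real (tower x - mean) - P x = complex_of_real (\<Sum>k. layer (k + K) x)"
          using suminf_split_initial_segment[OF that, of K] by (simp add: tower_def P_def)
        then show ?thesis by (simp only: norm_of_real power2_abs)
      qed
      have "AE x in circle_measure. summable (\<lambda>k. layer k x)"
        using AE_summable_layer[of 1 1] by simp
      then have "AE x in circle_measure. (norm (complex_of_real (tower x - mean) - P x))\<^sup>2 = (\<Sum>k. layer (k + K) x)\<^sup>2"
        by (rule eventually_mono) (rule eq)
      then show ?thesis
        unfolding L2_norm_circle_def by (intro arg_cong[where f = sqrt] integral_cong_AE) measurable
    qed
    also have "\<dots> \<le> sqrt (C / 2 ^ K)" using C(2)[of K] by simp
    finally show ?thesis .
  qed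
  then show ?thesis using C(1) that by blast
qed

lemma L2_tower_rate:
  assumes "0 < c" "c \<le> 1 / 2"
  shows "\<exists>K>0. \<forall>\<^sub>F N in sequentially.
     L2_norm_circle (\<lambda>x. complex_of_real (tower x - mean)
          - fourier_partial_sum N (\<lambda>y. complex_of_real (tower y - mean)) x)
       \<le> K * ln (ln (real N)) powr (- c)"
proof -
  obtain C where C: "0 < C"
    "\<And>K N. (\<And>k. k < K \<Longrightarrow> 2 ^ 2 ^ 2 ^ (k + 3) \<le> N) \<Longrightarrow>
      L2_norm_circle (\<lambda>x. complex_of_real (tower x - mean)
          - fourier_partial_sum N (\<lambda>y. complex_of_real (tower y - mean)) x) \<le> sqrt (C / 2 ^ K)"
    using L2_tower_tail by blast
  have "\<forall>\<^sub>F N in sequentially. 1 \<le> ln (ln (real N))" by real_asymp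
  then have "\<forall>\<^sub>F N in sequentially.
     L2_norm_circle (\<lambda>x. complex_of_real (tower x - mean)
          - fourier_partial_sum N (\<lambda>y. complex_of_real (tower y - mean)) x)
       \<le> sqrt (8 * C) * ln (ln (real N)) powr (- c)"
    \<comment> \<open>The bound 3 exceeds Euler's number, so \<open>ln (real N)\<close> is at least
      1, as the second use of \<open>ln_less\<close> demands.\<close>
    using eventually_ge_at_top[of 3]
  proof eventually_elim
    case (elim N)
    \<comment> \<open>All layers below \<open>K\<close> fit under the frequency \<open>N\<close>,
      while minimality is not far from sharp: \<open>N\<close> lies below the next threshold, whence
      \<open>ln (ln (real N)) < 2 ^ (K + 3)\<close> and \<open>2 ^ - K\<close> is at most
      \<open>8 / ln (ln (real N))\<close>.\<close>
    define K where "K = (LEAST k. N < 2 ^ 2 ^ 2 ^ (k + 3))"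
    have ex: "N < 2 ^ 2 ^ 2 ^ (N + 3)"
    proof -
      have "N < 2 ^ N" by (rule less_exp)
      also have "\<dots> \<le> 2 ^ 2 ^ 2 ^ (N + 3)"
        by (intro power_increasing order.trans[OF _ less_imp_le[OF less_exp]]
            order.trans[OF _ less_imp_le[OF less_exp]]) auto
      finally show ?thesis .
    qed
    have lt: "N < 2 ^ 2 ^ 2 ^ (K + 3)"
      unfolding K_def by (rule LeastI[of "\<lambda>k. N < 2 ^ 2 ^ 2 ^ (k + 3)", OF ex])
    have "2 ^ 2 ^ 2 ^ (k + 3) \<le> N" if "k < K" for k
      using not_less_Least[of k "\<lambda>k. N < 2 ^ 2 ^ 2 ^ (k + 3)"] that by (simp add: K_def not_less)
    then have "L2_norm_circle (\<lambda>x. complex_of_real (tower x - mean)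
          - fourier_partial_sum N (\<lambda>y. complex_of_real (tower y - mean)) x) \<le> sqrt (C / 2 ^ K)"
      by (rule C(2))
    also have "C / 2 ^ K \<le> 8 * C * (1 / ln (ln (real N)))"
    proof -
      have ln_less: "ln y < 2 ^ k" if "y < 2 ^ 2 ^ k" "1 \<le> y" for y :: real and k :: nat
      proof -
        have "ln y < ln (2 ^ 2 ^ k)" using that by (subst ln_less_cancel_iff) auto
        also have "\<dots> = 2 ^ k * ln 2" by (simp add: ln_realpow)
        also have "\<dots> \<le> 2 ^ k * 1" using ln_2_less_1 by (intro mult_left_mono) auto
        finally show ?thesis by simp
      qed
      have "real N < real (2 ^ 2 ^ 2 ^ (K + 3))" using lt by (simp only: of_nat_less_iff)
      then have "ln (real N) < 2 ^ 2 ^ (K + 3)" using elim by (intro ln_less) auto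
      moreover have "1 \<le> ln (real N)"
        using elim ln_ge_iff[of "real N" 1] exp_le by simp
      ultimately have "ln (ln (real N)) < 2 ^ (K + 3)" by (rule ln_less)
      moreover have "C / 2 ^ K \<le> 8 * C * (1 / L)" if "1 \<le> L" "L < 2 ^ (K + 3)" for L :: real
      proof -
        have "C * L \<le> C * (8 * 2 ^ K)"
          using C(1) that by (intro mult_left_mono) (auto simp: power_add)
        then show ?thesis using that by (simp add: divide_simps mult_ac)
      qed
      ultimately show ?thesis using elim(1) by blast
    qed
    also have "sqrt (8 * C * (1 / ln (ln (real N)))) = sqrt (8 * C) * ln (ln (real N)) powr (- (1 / 2))"
    proof -
      have "ln (ln (real N)) powr (1 / 2) = sqrt (ln (ln (real N)))"
        using elim(1) by (intro powr_half_sqrt) linarith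
      then show ?thesis by (simp add: real_sqrt_mult real_sqrt_divide powr_minus_divide)
    qed
    \<comment> \<open>The rate with exponent 1/2 covers all smaller \<open>c\<close>, because the
      base is at least 1.\<close>
    also have "ln (ln (real N)) powr (- (1 / 2)) \<le> ln (ln (real N)) powr (- c)"
      using elim assms by (intro powr_mono) auto
    finally show ?case using C(1) by (simp add: mult_left_mono)
  qed
  moreover have "0 < sqrt (8 * C)" using C(1) by simp
  ultimately show ?thesis by blast
qed

text \<open>
  A zero digit in the second half of the windows remains inside the window range after a shift by at
  most \<open>reps m\<close> digits, so it is seen by all dilations of the block.
\<close>
lemma layer_ge_on_block:
  assumes digit: "frac (2 ^ (start m + digits m * (reps m + i)) * x) < 1 / 2 ^ digits m"
    and i: "i < reps m" and j: "2 ^ m \<le> j" "j < 2 ^ (m + 1)"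
  shows "height (floor_log m) / 2 \<le> layer (floor_log m) (real (dilation j) * x)"
proof -
  define t where "t = j - 2 ^ m"
  have m: "floor_log j = m" using j by (intro floor_log_eqI) auto
  have t: "t \<le> reps m" using j two_power_le_reps[of m] by (simp add: t_def)
  have "dilation j = 2 ^ (start m + digits m * t)" by (simp add: dilation_def m t_def)
  moreover have "digits m * (reps m + i - t) + (start m + digits m * t) = start m + digits m * (reps m + i)"
  proof -
    have "digits m * (reps m + i - t) + digits m * t = digits m * (reps m + i)"
      using t by (simp flip: distrib_left)
    then show ?thesis by simp
  qed
  ultimately have eq: "2 ^ (digits m * (reps m + i - t)) * (real (dilation j) * x)
      = 2 ^ (start m + digits m * (reps m + i)) * x"
    by (simp flip: power_add mult.assoc)
  have "frac (2 ^ (digits m * (reps m + i - t)) * (real (dilation j) * x)) < 1 / 2 ^ digits m"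
    unfolding eq by (rule digit)
  moreover have "reps m + i - t < 2 * windows (floor_log m)" using i by (simp add: reps_def)
  ultimately have "1 / 2 \<le> bump (width (floor_log m)) (2 * windows (floor_log m)) (real (dilation j) * x)"
    unfolding digits_def by (intro bump_ge_half)
  then show ?thesis
    using height_pos[of "floor_log m"] mult_left_mono[of "1/2" _ "height (floor_log m)"]
    by (simp add: layer_def less_imp_le)
qed

text \<open>The index \<open>N\<close> is the last one of block \<open>m\<close>, and the block
  makes up more than half of the indices up to \<open>N\<close>. The average is thus at least half
  of the value on the block, since the earlier terms are nonnegative before the mean is
  subtracted.\<close>

lemma average_ge_on_block:
  assumes s: "\<And>D. 0 < D \<Longrightarrow> summable (\<lambda>k. layer k (real D * x))"
    and digit: "frac (2 ^ (start m + digits m * (reps m + i)) * x) < 1 / 2 ^ digits m"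
    and i: "i < reps m" and N: "N = 2 ^ (m + 1) - 1"
  shows "height (floor_log m) / 4 - mean \<le> 1 / real N * (\<Sum>j=1..N. tower (real (dilation j) * x) - mean)"
proof -
  let ?h = "height (floor_log m)"
  have N0: "0 < N" using N less_exp[of "m + 1"] by simp
  have B: "{2 ^ m..<2 ^ (m + 1)} \<subseteq> {1..N}"
    using N by auto
  have ge: "layer k (real (dilation j) * x) \<le> tower (real (dilation j) * x)" for k j
    unfolding tower_def using sum_le_suminf[OF s[OF dilation_pos], of "{k}"] layer_nonneg by simp
  have ge0: "0 \<le> tower (real (dilation j) * x)" for j
    using ge[of 0 j] layer_nonneg order.trans by blast
  have "real N * (?h / 4) \<le> 2 ^ m * (?h / 2)"
  proof -
    have "real N \<le> 2 ^ (m + 1)" by (simp add: N of_nat_diff)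
    then have "real N * (?h / 4) \<le> 2 ^ (m + 1) * (?h / 4)"
      using height_pos[of "floor_log m"] by (intro mult_right_mono) auto
    then show ?thesis by (simp add: mult_ac)
  qed
  also have "\<dots> = (\<Sum>j\<in>{2 ^ m..<2 ^ (m + 1) :: nat}. ?h / 2)" by simp
  also have "\<dots> \<le> (\<Sum>j\<in>{2 ^ m..<2 ^ (m + 1) :: nat}. tower (real (dilation j) * x))"
    by (intro sum_mono order.trans[OF layer_ge_on_block[OF digit i] ge]) auto
  also have "\<dots> \<le> (\<Sum>j=1..N. tower (real (dilation j) * x))"
    using B ge0 by (intro sum_mono2) auto
  finally have "real N * (?h / 4 - mean) \<le> (\<Sum>j=1..N. tower (real (dilation j) * x) - mean)"
    by (simp add: sum_subtractf right_diff_distrib)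
  then show ?thesis using N0 by (simp add: field_simps)
qed

lemma limsup_eq_infinityI:
  assumes "\<And>B N\<^sub>0. \<exists>N\<ge>N\<^sub>0. B \<le> u N"
  shows "limsup (\<lambda>N. ereal (u N)) = \<infinity>"
proof (rule ereal_top)
  fix B
  show "ereal B \<le> limsup (\<lambda>N. ereal (u N))"
  proof (rule ccontr)
    assume "\<not> ?thesis"
    then have "\<forall>\<^sub>F N in sequentially. ereal (u N) < ereal B"
      by (intro Limsup_lessD) (simp add: not_le)
    then obtain M where "\<And>N. M \<le> N \<Longrightarrow> u N < B" by (auto simp: eventually_sequentially)
    then show False using assms[of M B] by (meson not_le)
  qed
qed

lemma AE_limsup_tower:
  "AE x in circle_measure.
     limsup (\<lambda>N. ereal (1 / real N * (\<Sum>j=1..N. tower (real (dilation j) * x) - mean))) = \<infinity>"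
proof -
  \<comment> \<open>There are countably many dilation factors, so a single null set serves all of
    them.\<close>
  have "AE x in circle_measure. \<forall>D. 0 < D \<longrightarrow> summable (\<lambda>k. layer k (real D * x))"
    unfolding AE_all_countable using AE_summable_layer[of _ 1] by simp
  moreover have "AE x in circle_measure. \<forall>m. \<exists>m'\<ge>m. \<exists>i<reps m'.
      frac (2 ^ (start m' + digits m' * (reps m' + i)) * x) < 1 / 2 ^ digits m'"
    by (rule AE_infinitely_often_zero_digit[OF _ not_summable_reps]) simp
  ultimately show ?thesis
  proof eventually_elim
    case (elim x)
    show ?case
    proof (rule limsup_eq_infinityI)
      fix B :: real and N\<^sub>0 :: nat
      have "\<forall>\<^sub>F k in sequentially. B \<le> sqrt ((real k + 1) / 2) / 4 - mean" by real_asymp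
      then obtain k\<^sub>0 where k0: "\<And>k. k\<^sub>0 \<le> k \<Longrightarrow> B \<le> sqrt ((real k + 1) / 2) / 4 - mean"
        by (auto simp: eventually_sequentially)
      obtain m i where m: "max (2 ^ k\<^sub>0) N\<^sub>0 \<le> m" and i: "i < reps m"
        and d: "frac (2 ^ (start m + digits m * (reps m + i)) * x) < 1 / 2 ^ digits m"
        using elim(2) by blast
      \<comment> \<open>Choosing \<open>m\<close> beyond \<open>2 ^ k\<^sub>0\<close> forces its
        block to be devoted to a layer of index at least \<open>k\<^sub>0\<close>, whose height is
        large.\<close>
      have "k\<^sub>0 \<le> floor_log m"
        using m floor_log_le_iff[of "2 ^ k\<^sub>0" m] by simp
      then have "B \<le> height (floor_log m) / 4 - mean"
        using k0[of "floor_log m"] height_ge[of "floor_log m"] by linarith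
      also have "\<dots> \<le> 1 / real (2 ^ (m + 1) - 1) * (\<Sum>j=1..2 ^ (m + 1) - 1. tower (real (dilation j) * x) - mean)"
        using average_ge_on_block[OF _ d i refl] elim(1) by blast
      finally have "B \<le> 1 / real (2 ^ (m + 1) - 1) * (\<Sum>j=1..2 ^ (m + 1) - 1. tower (real (dilation j) * x) - mean)" .
      moreover have "N\<^sub>0 \<le> 2 ^ (m + 1) - 1"
        using m less_exp[of "m + 1"] by linarith
      ultimately show "\<exists>N\<ge>N\<^sub>0. B \<le> 1 / real N * (\<Sum>j=1..N. tower (real (dilation j) * x) - mean)"
        by blast
    qed
  qed
qed

theorem corollary1p5:
  fixes c :: real
  assumes "0 < c" and "c \<le> 1 / 2"
  shows "\<exists>(f :: real \<Rightarrow> real) (n :: nat \<Rightarrow> nat).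
           (\<forall>p\<ge>1. f \<in> Lp_circle p) \<and>
           (LINT x|circle_measure. f x) = 0 \<and>
           (\<forall>j\<ge>1. 0 < n j) \<and>
           strict_mono_on {1..} n \<and>
           (\<forall>j\<ge>1. real (n (j + 1)) / real (n j) \<ge> 2) \<and>
           (\<exists>K>0. \<forall>\<^sub>F N in sequentially.
              L2_norm_circle (\<lambda>x. complex_of_real (f x)
                  - fourier_partial_sum N (\<lambda>y. complex_of_real (f y)) x)
              \<le> K * ln (ln (real N)) powr (- c)) \<and>
           (AE x in circle_measure.
              limsup (\<lambda>N. ereal (1 / real N * (\<Sum>j = 1..N. f (real (n j) * x)))) = \<infinity>)"
proof (intro exI[of _ "\<lambda>x. tower x - mean"] exI[of _ dilation] conjI allI impI)
  show "(\<lambda>x. tower x - mean) \<in> Lp_circle p" if "1 \<le> p" for p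
    by (rule tower_Lp[OF that])
  show "(LINT x|circle_measure. tower x - mean) = 0"
    by (rule integral_tower_minus_mean)
  show "0 < dilation j" for j
    by (rule dilation_pos)
  show "2 \<le> real (dilation (j + 1)) / real (dilation j)" if "1 \<le> j" for j
  proof -
    have "real (2 * dilation j) \<le> real (dilation (j + 1))"
      using dilation_Suc[OF that] by (simp only: of_nat_le_iff)
    then show ?thesis using dilation_pos[of j] by (simp add: field_simps)
  qed
  show "strict_mono_on {1..} dilation"
  proof (rule strict_mono_onI)
    fix a b :: nat assume "a \<in> {1..}" "a < b"
    have "dilation j < dilation (Suc j)" if "a \<le> j" for j
      using dilation_Suc[of j] dilation_pos[of j] that \<open>a \<in> {1..}\<close> by simp
    then have "dilation a < dilation (a + Suc d)" for d
      by (induction d) (auto intro: less_trans)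
    from this[of "b - Suc a"] \<open>a < b\<close> show "dilation a < dilation b" by simp
  qed
  show "AE x in circle_measure.
     limsup (\<lambda>N. ereal (1 / real N * (\<Sum>j=1..N. tower (real (dilation j) * x) - mean))) = \<infinity>"
    by (rule AE_limsup_tower)
\<comment> \<open>The exponent \<open>c\<close> enters only here: the same function and the same
  dilations serve every \<open>c\<close>.\<close>
qed (rule L2_tower_rate[OF assms])

end
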